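(* Let $R_N$ be a regular $2N$-gon with unit sides, let $\mathbb T$ be any rhombus tiling of $R_N$, and let $\Lambda^{R_N}$ be the response matrix of the electrical network $G_{\mathbb T}$. Then for all $1\le p,q\le N$, with $d=|p-q|$, $$\Lambda^{R_N}_{p,q}=\frac{\sin(\pi/N)}{N\,\sin\big((2d-1)\pi/(2N)\big)\,\sin\big((2d+1)\pi/(2N)\big)}.$$
   Context: Rhombus tilings and electrical networks: $R$ is a polygonal region tiled by a rhombus tiling $\mathbb T$ with all sides of length 1; the vertices of $\mathbb T$ are colored black and white bipartitely. $G_{\mathbb T}$ is the graph whose vertices are the black vertices of $\mathbb T$ and whose edges are the diagonals $AC$ of rhombi $ABCD$ with $A,C$ black; this edge is a resistor of resistance $|AC|/|BD|$. The black vertices on the boundary of $R$ are $B_1,\dots,B_N$ in clockwise order. Applying voltage 1 at $B_p$ and 0 at all other boundary vertices and solving by Ohm's and Kirchhoff's laws, $\Lambda^R_{p,q}$ is the current flowing out of the network at $B_q$ (so $\Lambda^R_{p,q}\ge0$ for $p\neq q$, and $\Lambda^R_{p,p}\le 0$ is minus the current entering at $B_p$). The matrix $\Lambda^R=(\Lambda^R_{p,q})$ is the response matrix. *)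

theory Defs
  imports "HOL-Analysis.Analysis"
begin

text \<open>Points of the plane are complex numbers. A rhombus is a quadruple (A,B,C,D) of
 consecutive corners with unit sides; its two diagonals are AC and BD.\<close>

type_synonym rhomb = "complex \<times> complex \<times> complex \<times> complex"

definition corners :: "rhomb \<Rightarrow> complex set" where
  "corners t = (case t of (A,B,C,D) \<Rightarrow> {A,B,C,D})"

definition is_unit_rhombus :: "rhomb \<Rightarrow> bool" where
  "is_unit_rhombus t = (case t of (A,B,C,D) \<Rightarrow>
     cmod (B - A) = 1 \<and> cmod (C - B) = 1 \<and> cmod (D - C) = 1 \<and> cmod (A - D) = 1 \<and>
     A + C = B + D \<and> A \<noteq> C \<and> B \<noteq> D)"

definition tile_region :: "rhomb \<Rightarrow> complex set" where
  "tile_region t = convex hull (corners t)"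

definition rhombus_tiling :: "rhomb set \<Rightarrow> complex set \<Rightarrow> bool" where
  "rhombus_tiling T R \<longleftrightarrow> finite T \<and> (\<forall>t\<in>T. is_unit_rhombus t) \<and>
     (\<Union>t\<in>T. tile_region t) = R \<and>
     (\<forall>t\<in>T. \<forall>t'\<in>T. t \<noteq> t' \<longrightarrow> interior (tile_region t) \<inter> interior (tile_region t') = {}) \<and>
     (\<forall>t\<in>T. \<forall>t'\<in>T. \<forall>v\<in>corners t. v \<in> tile_region t' \<longrightarrow> v \<in> corners t')"

definition tiling_vertices :: "rhomb set \<Rightarrow> complex set" where
  "tiling_vertices T = (\<Union>t\<in>T. corners t)"

definition proper_coloring :: "rhomb set \<Rightarrow> (complex \<Rightarrow> bool) \<Rightarrow> bool" where
  "proper_coloring T col \<longleftrightarrow> (\<forall>t\<in>T. case t of (A,B,C,D) \<Rightarrow>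
      col A = col C \<and> col B = col D \<and> col A \<noteq> col B)"

definition black_vertices :: "rhomb set \<Rightarrow> (complex \<Rightarrow> bool) \<Rightarrow> complex set" where
  "black_vertices T col = {v \<in> tiling_vertices T. col v}"

definition black_diag :: "(complex \<Rightarrow> bool) \<Rightarrow> rhomb \<Rightarrow> complex \<times> complex" where
  "black_diag col t = (case t of (A,B,C,D) \<Rightarrow> if col A then (A,C) else (B,D))"

definition white_diag :: "(complex \<Rightarrow> bool) \<Rightarrow> rhomb \<Rightarrow> complex \<times> complex" where
  "white_diag col t = (case t of (A,B,C,D) \<Rightarrow> if col A then (B,D) else (A,C))"

definition diag_len :: "complex \<times> complex \<Rightarrow> real" where
  "diag_len e = cmod (snd e - fst e)"

text \<open>Conductance (= 1/resistance, resistance = |AC|/|BD|) between black vertices x and y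
 of the network G_T: sum over rhombi whose black diagonal is xy.\<close>
definition conductance :: "rhomb set \<Rightarrow> (complex \<Rightarrow> bool) \<Rightarrow> complex \<Rightarrow> complex \<Rightarrow> real" where
  "conductance T col x y =
     (\<Sum>t\<in>{t\<in>T. black_diag col t = (x,y) \<or> black_diag col t = (y,x)}.
        diag_len (white_diag col t) / diag_len (black_diag col t))"

text \<open>Net current flowing out of the network at black vertex x under potential u.\<close>
definition current_out :: "rhomb set \<Rightarrow> (complex \<Rightarrow> bool) \<Rightarrow> (complex \<Rightarrow> real) \<Rightarrow> complex \<Rightarrow> real" where
  "current_out T col u x = (\<Sum>y\<in>black_vertices T col. conductance T col x y * (u y - u x))"

definition boundary_black :: "rhomb set \<Rightarrow> (complex \<Rightarrow> bool) \<Rightarrow> complex set \<Rightarrow> complex set" where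
  "boundary_black T col R = {v \<in> black_vertices T col. v \<in> frontier R}"

definition dirichlet_potential ::
  "rhomb set \<Rightarrow> (complex \<Rightarrow> bool) \<Rightarrow> complex set \<Rightarrow> complex \<Rightarrow> (complex \<Rightarrow> real)" where
  "dirichlet_potential T col R b = (THE u.
     u b = 1 \<and>
     (\<forall>v\<in>boundary_black T col R. v \<noteq> b \<longrightarrow> u v = 0) \<and>
     (\<forall>x\<in>black_vertices T col - boundary_black T col R. current_out T col u x = 0) \<and>
     (\<forall>x. x \<notin> black_vertices T col \<longrightarrow> u x = 0))"

definition response :: "rhomb set \<Rightarrow> (complex \<Rightarrow> bool) \<Rightarrow> complex set \<Rightarrow> (nat \<Rightarrow> complex)
     \<Rightarrow> nat \<Rightarrow> nat \<Rightarrow> real" where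
  "response T col R B p q = current_out T col (dirichlet_potential T col R (B p)) (B q)"

text \<open>Regular 2N-gon with unit sides, centre c, rotation a; corners listed clockwise.\<close>
definition poly_vertex :: "nat \<Rightarrow> complex \<Rightarrow> real \<Rightarrow> nat \<Rightarrow> complex" where
  "poly_vertex N c a k = c + complex_of_real (1 / (2 * sin (pi / (2 * real N)))) *
                            cis (a - pi * real k / real N)"

definition reg_polygon :: "nat \<Rightarrow> complex \<Rightarrow> real \<Rightarrow> complex set" where
  "reg_polygon N c a = convex hull (poly_vertex N c a ` {0..<2*N})"

end

theory Submission
  imports Defs
begin

text \<open>A function \<open>F\<close> on the vertices is discrete holomorphic if on every tile \<open>ABCD\<close> the difference
  quotients along \<open>AC\<close> and \<open>BD\<close> agree. Its real part on the black vertices is then a potential whose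
  current at a vertex \<open>v\<close> is the sum of \<open>Im (F D - F B)\<close> over the tiles \<open>vBCD\<close>: this telescopes to
  zero at interior vertices, and at a corner of the polygon to a difference of two white boundary
  values. The functions with \<open>F (v + e) = F v * (z + e) / (z - e)\<close> along all edges \<open>e\<close> are discrete
  holomorphic, and their values on the boundary do not depend on the tiling. Varying \<open>z\<close>,
  they span all boundary data \<open>k \<mapsto> \<Sum>j\<le>N. b j * q ^ (k * j)\<close> with \<open>q = cis (- pi / N)\<close>. A suitable choice
  of \<open>b\<close> gives the Dirichlet datum on the black corners and a cotangent on the white ones, whose
  difference is the claimed entry.\<close>

section \<open>Tiles around a vertex\<close>

text \<open>The tiling is given as a cover by rhombi with disjoint interiors, without any cyclic
  order of the tiles at a vertex. None is constructed: the telescoping only compares the set of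
  first edges with the set of second edges at a vertex, and edges are matched one at a time, using
  convexity of the region. The second obstacle is the existence of functions with prescribed ratios
  along edges. Around one rhombus the ratios multiply to 1, because those of \<open>e\<close> and
  \<open>- e\<close> cancel, but passing from single tiles to the whole tiling is a topological
  matter. Vertices are therefore added in the order of a generic linear height, where only the edges
  going down from the new vertex have to agree. The spanning claim rests on one polynomial: opposite
  sides of the polygon differ by a sign, so after scaling the boundary values are polynomials in
  \<open>z\<close>; one step along the boundary multiplies their coefficients by powers of
  \<open>q\<close>, and no coefficient vanishes.\<close>

definition wedge :: "complex \<Rightarrow> complex \<Rightarrow> real" where
  "wedge x y = Re x * Im y - Im x * Re y"

lemma wedge_add_left: "wedge (x + y) z = wedge x z + wedge y z"
  and wedge_add_right: "wedge x (y + z) = wedge x y + wedge x z"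
  and wedge_diff_left: "wedge (x - y) z = wedge x z - wedge y z"
  and wedge_diff_right: "wedge x (y - z) = wedge x y - wedge x z"
  and wedge_minus_left: "wedge (- x) z = - wedge x z"
  and wedge_minus_right: "wedge x (- z) = - wedge x z"
  and wedge_scaleR_left: "wedge (r *\<^sub>R x) z = r * wedge x z"
  and wedge_scaleR_right: "wedge x (r *\<^sub>R z) = r * wedge x z"
  and wedge_self: "wedge x x = 0"
  and wedge_0_left: "wedge 0 x = 0"
  and wedge_0_right: "wedge x 0 = 0"
  by (simp_all add: wedge_def algebra_simps)

lemmas wedge_simps = wedge_add_left wedge_add_right wedge_diff_left wedge_diff_right
  wedge_minus_left wedge_minus_right wedge_scaleR_left wedge_scaleR_right wedge_self
  wedge_0_left wedge_0_right

lemma wedge_commute: "wedge x y = - wedge y x"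
  by (simp add: wedge_def)

lemma continuous_on_wedge [continuous_intros]:
  "continuous_on S f \<Longrightarrow> continuous_on S g \<Longrightarrow> continuous_on S (\<lambda>x. wedge (f x) (g x))"
  unfolding wedge_def by (intro continuous_intros)

text \<open>Cramer's rule with \<open>wedge\<close> as determinant. It turns membership in a cone
  into the signs of two coordinates.\<close>

lemma wedge_coordinates:
  assumes "wedge u w \<noteq> 0"
  shows "x = (wedge x w / wedge u w) *\<^sub>R u + (wedge u x / wedge u w) *\<^sub>R w"
proof -
  have "wedge u w *\<^sub>R x = wedge x w *\<^sub>R u + wedge u x *\<^sub>R w"
    by (rule complex_eqI) (simp_all add: wedge_def algebra_simps)
  then have "inverse (wedge u w) *\<^sub>R (wedge u w *\<^sub>R x) =
      inverse (wedge u w) *\<^sub>R (wedge x w *\<^sub>R u + wedge u x *\<^sub>R w)"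
    by simp
  then show ?thesis
    using assms by (simp add: scaleR_add_right divide_inverse mult.commute)
qed

lemma unit_parallel:
  assumes "cmod x = 1" "cmod y = 1" "wedge x y = 0"
  shows "x = y \<or> x = - y"
proof -
  have 1: "(Re x)\<^sup>2 + (Im x)\<^sup>2 = 1" "(Re y)\<^sup>2 + (Im y)\<^sup>2 = 1"
    using assms by (simp_all add: cmod_def)
  have 2: "Re x * Im y = Im x * Re y"
    using assms by (simp add: wedge_def)
  let ?p = "Re x * Re y + Im x * Im y"
  have "?p\<^sup>2 = ((Re x)\<^sup>2 + (Im x)\<^sup>2) * ((Re y)\<^sup>2 + (Im y)\<^sup>2) - (Re x * Im y - Im x * Re y)\<^sup>2"
    by (simp add: power2_eq_square algebra_simps)
  then have "?p\<^sup>2 = 1"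
    using 1 2 by simp
  then have p: "?p = 1 \<or> ?p = - 1"
    by (simp add: power2_eq_1_iff)
  have "(Re x - ?p * Re y)\<^sup>2 + (Im x - ?p * Im y)\<^sup>2
      = (Re x)\<^sup>2 + (Im x)\<^sup>2 - 2 * ?p\<^sup>2 + ?p\<^sup>2 * ((Re y)\<^sup>2 + (Im y)\<^sup>2)"
    by (simp add: power2_eq_square algebra_simps)
  then have "(Re x - ?p * Re y)\<^sup>2 + (Im x - ?p * Im y)\<^sup>2 = 0"
    using 1 \<open>?p\<^sup>2 = 1\<close> by simp
  then have "Re x = ?p * Re y \<and> Im x = ?p * Im y"
    by (simp add: sum_power2_eq_zero_iff)
  with p show ?thesis
    by (auto intro: complex_eqI)
qed

text \<open>The sign of the wedge product puts the edges \<open>u\<close>, \<open>w\<close> at \<open>v\<close> in counterclockwise order.\<close>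

definition tile_corner :: "rhomb \<Rightarrow> complex \<Rightarrow> complex \<Rightarrow> complex \<Rightarrow> bool" where
  "tile_corner t v u w \<longleftrightarrow> cmod u = 1 \<and> cmod w = 1 \<and> wedge u w > 0 \<and>
     (case t of (A,B,C,D) \<Rightarrow>
        ({v, v + u + w} = {A,C} \<and> {v + u, v + w} = {B,D}) \<or>
        ({v, v + u + w} = {B,D} \<and> {v + u, v + w} = {A,C}))"

lemma tile_corner_corners:
  assumes "tile_corner t v u w"
  shows "corners t = {v, v + u, v + w, v + u + w}"
proof -
  obtain A B C D where t: "t = (A,B,C,D)" by (cases t)
  have "corners t = {A,C} \<union> {B,D}"
    by (auto simp: t corners_def)
  also have "\<dots> = {v, v + u + w} \<union> {v + u, v + w}"
    using assms unfolding tile_corner_def t prod.case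
    by (elim conjE disjE) (simp_all only: Un_commute)
  also have "\<dots> = {v, v + u, v + w, v + u + w}"
    by blast
  finally show ?thesis .
qed

text \<open>Iterated, this walks counterclockwise around the tile, so a description at one corner
  yields one at every corner.\<close>

lemma tile_corner_rotate:
  assumes "tile_corner t v u w"
  shows "tile_corner t (v + u) w (- u)"
proof -
  have "v + u + w + - u = v + w" "v + u + - u = v" "wedge w (- u) = wedge u w"
    by (simp_all add: wedge_def)
  then show ?thesis
    using assms unfolding tile_corner_def
    by (cases t) (auto simp: insert_commute)
qed

lemma is_unit_rhombus_tile_corner:
  assumes "is_unit_rhombus (A,B,C,D)"
  shows "\<exists>u w. tile_corner (A,B,C,D) A u w"
proof -
  define u w where "u = B - A" and "w = D - A"
  have B: "B = A + u" and D: "D = A + w" by (auto simp: u_def w_def)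
  have C: "C = A + u + w" using assms by (simp add: is_unit_rhombus_def u_def w_def algebra_simps)
  have n: "cmod u = 1" "cmod w = 1" and ne: "u \<noteq> w" "u \<noteq> - w"
    using assms by (auto simp: is_unit_rhombus_def B C D norm_minus_commute eq_neg_iff_add_eq_0 add.assoc)
  then have "wedge u w \<noteq> 0"
    using unit_parallel by blast
  \<comment> \<open>A quadruple may list its corners in either sense; the sign decides which edge
    comes first.\<close>
  then consider "wedge u w > 0" | "wedge w u > 0"
    using wedge_commute[of u w] by linarith
  then show ?thesis
  proof cases
    case 1
    then have "tile_corner (A,B,C,D) A u w"
      unfolding tile_corner_def using n by (simp add: B C D)
    then show ?thesis by blast
  next
    case 2
    then have "tile_corner (A,B,C,D) A w u"
      unfolding tile_corner_def using n by (simp add: B C D insert_commute algebra_simps)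
    then show ?thesis by blast
  qed
qed

lemma tile_corner_exists:
  assumes "is_unit_rhombus t" "v \<in> corners t"
  shows "\<exists>u w. tile_corner t v u w"
proof -
  obtain A B C D where t: "t = (A,B,C,D)" by (cases t)
  obtain u w where uw: "tile_corner t A u w"
    using is_unit_rhombus_tile_corner assms(1) t by blast
  note r1 = tile_corner_rotate[OF uw]
  note r2 = tile_corner_rotate[OF r1]
  note r3 = tile_corner_rotate[OF r2]
  have "v = A \<or> v = A + u \<or> v = A + u + w \<or> v = A + u + w - u"
    using assms(2) tile_corner_corners[OF uw] by auto
  then show ?thesis
    using uw r1 r2 r3 by auto
qed

definition first_edge :: "rhomb \<Rightarrow> complex \<Rightarrow> complex" where
  "first_edge t v = fst (SOME p. tile_corner t v (fst p) (snd p))"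

definition second_edge :: "rhomb \<Rightarrow> complex \<Rightarrow> complex" where
  "second_edge t v = snd (SOME p. tile_corner t v (fst p) (snd p))"

lemma tile_corner_edges:
  assumes "is_unit_rhombus t" "v \<in> corners t"
  shows "tile_corner t v (first_edge t v) (second_edge t v)"
proof -
  have "\<exists>p. tile_corner t v (fst p) (snd p)"
    using tile_corner_exists[OF assms] by simp
  then show ?thesis
    unfolding first_edge_def second_edge_def by (rule someI_ex)
qed

text \<open>For \<open>wedge u w > 0\<close> this is the closed convex cone spanned by
  \<open>u\<close> and \<open>w\<close>.\<close>

definition corner_cone :: "complex \<Rightarrow> complex \<Rightarrow> complex set" where
  "corner_cone u w = {x. wedge u x \<ge> 0 \<and> wedge x w \<ge> 0}"

lemma closed_corner_cone: "closed (corner_cone u w)"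
  unfolding corner_cone_def by (intro closed_Collect_conj closed_Collect_le continuous_intros)

lemma convex_wedge_ge: "convex {y. wedge u (y - v) \<ge> 0}" "convex {y. wedge (y - v) w \<ge> 0}"
proof -
  have "convex {y. 0 \<le> wedge x (y - v)}" for x
  proof (rule convexI)
    fix y z a b assume *: "y \<in> {y. 0 \<le> wedge x (y - v)}" "z \<in> {y. 0 \<le> wedge x (y - v)}"
      "0 \<le> a" "0 \<le> b" "a + b = (1::real)"
    have "wedge x ((a *\<^sub>R y + b *\<^sub>R z) - v) = a * wedge x (y - v) + b * wedge x (z - v) + (a + b - 1) * wedge x v"
      by (simp add: wedge_simps algebra_simps)
    then show "a *\<^sub>R y + b *\<^sub>R z \<in> {y. 0 \<le> wedge x (y - v)}"
      using * by simp
  qed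
  from this[of u] this[of "- w"]
  show "convex {y. wedge u (y - v) \<ge> 0}" "convex {y. wedge (y - v) w \<ge> 0}"
    by (simp_all add: wedge_minus_left wedge_commute[of w])
qed

lemma tile_corner_region_subset:
  assumes "tile_corner t v u w" "v + x \<in> tile_region t"
  shows "x \<in> corner_cone u w"
proof -
  let ?S = "{y. wedge u (y - v) \<ge> 0} \<inter> {y. wedge (y - v) w \<ge> 0}"
  have "wedge u w > 0" using assms(1) by (simp add: tile_corner_def)
  then have "corners t \<subseteq> ?S"
    using tile_corner_corners[OF assms(1)] by (auto simp: wedge_simps)
  then have "tile_region t \<subseteq> ?S"
    unfolding tile_region_def by (intro hull_minimal convex_Int convex_wedge_ge)
  then show ?thesis
    using assms(2) by (auto simp: corner_cone_def)
qed

text \<open>The inequalities cut out the open triangle \<open>v\<close>, \<open>v + u\<close>,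
  \<open>v + w\<close>. This half of the tile already contains a small multiple of every direction
  strictly inside the cone.\<close>

lemma tile_corner_interior:
  assumes "tile_corner t v u w" "wedge u x > 0" "wedge x w > 0"
    "wedge x w + wedge u x < wedge u w"
  shows "v + x \<in> interior (tile_region t)"
proof -
  let ?O = "{y. 0 < wedge u (y - v) \<and> 0 < wedge (y - v) w \<and>
      wedge (y - v) w + wedge u (y - v) < wedge u w}"
  have "open ?O"
    by (intro open_Collect_conj open_Collect_less continuous_intros)
  moreover have "?O \<subseteq> tile_region t"
  proof
    fix y assume y: "y \<in> ?O"
    define \<alpha> \<beta> where "\<alpha> = wedge (y - v) w / wedge u w" and "\<beta> = wedge u (y - v) / wedge u w"
    have D: "wedge u w > 0" using assms(1) by (simp add: tile_corner_def)
    have y': "y - v = \<alpha> *\<^sub>R u + \<beta> *\<^sub>R w"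
      unfolding \<alpha>_def \<beta>_def using D by (intro wedge_coordinates) auto
    have ab: "\<alpha> \<ge> 0" "\<beta> \<ge> 0" "\<alpha> + \<beta> \<le> 1"
      using y D by (auto simp: \<alpha>_def \<beta>_def simp flip: add_divide_distrib)
    have "y = (1 - \<alpha> - \<beta>) *\<^sub>R v + \<alpha> *\<^sub>R (v + u) + \<beta> *\<^sub>R (v + w)"
      using y' by (simp add: algebra_simps)
    then have "y \<in> convex hull {v, v + u, v + w}"
      unfolding convex_hull_3 using ab by force
    then show "y \<in> tile_region t"
      unfolding tile_region_def using tile_corner_corners[OF assms(1)]
        hull_mono[of "{v, v + u, v + w}" "corners t" convex] by auto
  qed
  ultimately have "?O \<subseteq> interior (tile_region t)"
    by (rule interior_maximal[rotated])
  then show ?thesis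
    using assms by auto
qed

section \<open>Tilings of a convex region: the cones of the tiles at a vertex\<close>

locale convex_tiling =
  fixes T :: "rhomb set" and R :: "complex set"
  assumes tiling: "rhombus_tiling T R" and convex_region: "convex R"
begin

lemma finite_T: "finite T"
  using tiling unfolding rhombus_tiling_def by blast

lemma unit_rhombus: "t \<in> T \<Longrightarrow> is_unit_rhombus t"
  using tiling unfolding rhombus_tiling_def by blast

lemma region_eq: "R = (\<Union>t\<in>T. tile_region t)"
  using tiling unfolding rhombus_tiling_def by blast

lemma tiles_disjoint:
  "\<lbrakk>t \<in> T; t' \<in> T; t \<noteq> t'\<rbrakk> \<Longrightarrow> interior (tile_region t) \<inter> interior (tile_region t') = {}"
  using tiling unfolding rhombus_tiling_def by blast

lemma corner_in_tile:
  "\<lbrakk>t \<in> T; t' \<in> T; v \<in> corners t; v \<in> tile_region t'\<rbrakk> \<Longrightarrow> v \<in> corners t'"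
  using tiling unfolding rhombus_tiling_def by blast

definition tiles_at :: "complex \<Rightarrow> rhomb set" where
  "tiles_at v = {t \<in> T. v \<in> corners t}"

lemma finite_tiles_at: "finite (tiles_at v)"
  using finite_T by (simp add: tiles_at_def)

lemma tiles_at_edges: "t \<in> tiles_at v \<Longrightarrow> tile_corner t v (first_edge t v) (second_edge t v)"
  by (simp add: tile_corner_edges unit_rhombus tiles_at_def)

lemma corners_subset_region: "corners t \<subseteq> tile_region t"
  unfolding tile_region_def by (rule hull_subset)

lemma corner_in_region: "t \<in> T \<Longrightarrow> v \<in> corners t \<Longrightarrow> v \<in> R"
  using corners_subset_region region_eq by blast

text \<open>A small multiple of a direction strictly inside both cones would be an interior point of
  both tiles.\<close>

lemma open_cones_disjoint:
  assumes "t \<in> T" "t' \<in> T" "t \<noteq> t'" "tile_corner t v u w" "tile_corner t' v u' w'"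
    and "wedge u x > 0" "wedge x w > 0" "wedge u' x > 0" "wedge x w' > 0"
  shows False
proof -
  have D: "wedge u w > 0" "wedge u' w' > 0"
    using assms by (auto simp: tile_corner_def)
  define m where "m = min (wedge u w) (wedge u' w')"
  define M where "M = (wedge x w + wedge u x) + (wedge x w' + wedge u' x)"
  have "m > 0" "M > 0" using D assms by (auto simp: m_def M_def)
  define d where "d = m / (2 * M)"
  have d: "d > 0" "d * M < m" using \<open>m > 0\<close> \<open>M > 0\<close> by (auto simp: d_def)
  have "d * (wedge x w + wedge u x) \<le> d * M" "d * (wedge x w' + wedge u' x) \<le> d * M"
    using d assms by (auto simp: M_def)
  then have "d * wedge x w + d * wedge u x < wedge u w" "d * wedge x w' + d * wedge u' x < wedge u' w'"
    using d by (auto simp: m_def algebra_simps)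
  then have "v + d *\<^sub>R x \<in> interior (tile_region t)" "v + d *\<^sub>R x \<in> interior (tile_region t')"
    using assms d by (auto intro!: tile_corner_interior simp: wedge_simps)
  then show False
    using tiles_disjoint assms by blast
qed

text \<open>If \<open>x\<close> were strictly inside the first cone, a small push by
  \<open>u' + w'\<close> would keep it there and move it strictly inside the second cone as
  well.\<close>

lemma direction_on_edge:
  assumes "t \<in> T" "t' \<in> T" "t \<noteq> t'" "tile_corner t v u w" "tile_corner t' v u' w'"
    and "x \<in> corner_cone u w" "x \<in> corner_cone u' w'"
  shows "wedge u x = 0 \<or> wedge x w = 0"
proof (rule ccontr)
  assume "\<not> ?thesis"
  then have x: "wedge u x > 0" "wedge x w > 0"
    using assms by (auto simp: corner_cone_def)
  have D: "wedge u w > 0" "wedge u' w' > 0"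
    using assms by (auto simp: tile_corner_def)
  have "((\<lambda>\<eta>. wedge u (x + \<eta> *\<^sub>R (u' + w'))) \<longlongrightarrow> wedge u x) (at_right 0)"
    "((\<lambda>\<eta>. wedge (x + \<eta> *\<^sub>R (u' + w')) w) \<longlongrightarrow> wedge x w) (at_right 0)"
    unfolding wedge_def by (auto intro!: tendsto_eq_intros)
  then have "\<forall>\<^sub>F \<eta> in at_right 0. wedge u (x + \<eta> *\<^sub>R (u' + w')) > 0"
    "\<forall>\<^sub>F \<eta> in at_right 0. wedge (x + \<eta> *\<^sub>R (u' + w')) w > 0"
    using x by (auto dest: order_tendstoD)
  moreover have "\<forall>\<^sub>F \<eta> in at_right (0::real). \<eta> > 0"
    by (simp add: eventually_at_right_less)
  ultimately have "\<forall>\<^sub>F \<eta> in at_right 0. \<eta> > 0 \<and> wedge u (x + \<eta> *\<^sub>R (u' + w')) > 0 \<and>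
      wedge (x + \<eta> *\<^sub>R (u' + w')) w > 0"
    by eventually_elim auto
  then obtain \<eta> where "\<eta> > 0" "wedge u (x + \<eta> *\<^sub>R (u' + w')) > 0" "wedge (x + \<eta> *\<^sub>R (u' + w')) w > 0"
    using eventually_happens'[of "at_right (0::real)"] by (auto simp: trivial_limit_at_right_real)
  moreover have "wedge u' (x + \<eta> *\<^sub>R (u' + w')) > 0" "wedge (x + \<eta> *\<^sub>R (u' + w')) w' > 0"
    using assms D \<open>\<eta> > 0\<close> by (auto simp: wedge_simps corner_cone_def intro!: add_nonneg_pos)
  ultimately show False
    using open_cones_disjoint assms by blast
qed

text \<open>The finitely many tiles that miss \<open>v\<close> form a closed set, hence stay away
  from \<open>v\<close>; a tile that contains the vertex \<open>v\<close> has it as a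
  corner.\<close>

lemma local_cover:
  assumes "v \<in> tiling_vertices T"
  obtains e where "e > 0"
    "\<And>y. y \<in> R \<Longrightarrow> dist v y < e \<Longrightarrow> \<exists>t\<in>T. v \<in> corners t \<and> y \<in> tile_region t"
proof -
  let ?K = "\<Union>t\<in>{t\<in>T. v \<notin> tile_region t}. tile_region t"
  have "compact (tile_region t)" for t
    unfolding tile_region_def corners_def
    by (intro finite_imp_compact_convex_hull) (auto split: prod.splits)
  then have "closed ?K"
    using finite_T by (intro closed_UN) (auto simp: compact_imp_closed)
  moreover have "v \<in> - ?K" by auto
  ultimately obtain e where e: "e > 0" "\<And>y. dist y v < e \<Longrightarrow> y \<in> - ?K"
    unfolding closed_def open_dist by blast
  show ?thesis
  proof (rule that[OF e(1)])
    fix y assume y: "y \<in> R" "dist v y < e"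
    then obtain t where t: "t \<in> T" "y \<in> tile_region t" using region_eq by blast
    then have "v \<in> tile_region t" using e(2)[of y] y(2) by (metis (mono_tags, lifting) ComplD UN_I dist_commute mem_Collect_eq)
    then show "\<exists>t\<in>T. v \<in> corners t \<and> y \<in> tile_region t"
      using assms t corner_in_tile unfolding tiling_vertices_def by blast
  qed
qed

text \<open>By convexity the segment from \<open>v\<close> to the given point stays in the region,
  and near \<open>v\<close> it is covered by tiles at \<open>v\<close>. Cones do not notice the
  scaling.\<close>

lemma cone_cover:
  assumes "v \<in> tiling_vertices T" "\<delta> > 0" "v + \<delta> *\<^sub>R x \<in> R"
  shows "\<exists>t\<in>tiles_at v. x \<in> corner_cone (first_edge t v) (second_edge t v)"
proof -
  obtain e where e: "e > 0"
    "\<And>y. y \<in> R \<Longrightarrow> dist v y < e \<Longrightarrow> \<exists>t\<in>T. v \<in> corners t \<and> y \<in> tile_region t"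
    using local_cover[OF assms(1)] by blast
  define s where "s = min 1 (e / (2 * (1 + norm (\<delta> *\<^sub>R x))))"
  have p: "1 + norm (\<delta> *\<^sub>R x) > 0" by (simp add: add_pos_nonneg)
  have s: "s > 0" "s \<le> 1" using e(1) p by (auto simp: s_def)
  have "s * norm (\<delta> *\<^sub>R x) \<le> (e / (2 * (1 + norm (\<delta> *\<^sub>R x)))) * (1 + norm (\<delta> *\<^sub>R x))"
    using e(1) p by (intro mult_mono) (auto simp: s_def)
  also have "\<dots> = e / 2" using p by (metis nonzero_mult_divide_mult_cancel_right2 times_divide_eq_left less_irrefl mult.commute)
  finally have small: "dist v (v + s *\<^sub>R (\<delta> *\<^sub>R x)) < e"
    using e(1) s by (simp add: dist_norm abs_mult mult.assoc)
  have "v \<in> R" using assms(1) corner_in_region by (auto simp: tiling_vertices_def)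
  then have "(1 - s) *\<^sub>R v + s *\<^sub>R (v + \<delta> *\<^sub>R x) \<in> R"
    using convex_region assms(3) s by (intro convexD) auto
  then have "v + s *\<^sub>R (\<delta> *\<^sub>R x) \<in> R" by (simp add: algebra_simps)
  then obtain t where t: "t \<in> T" "v \<in> corners t" "v + s *\<^sub>R (\<delta> *\<^sub>R x) \<in> tile_region t"
    using e(2) small by blast
  have "t \<in> tiles_at v" using t by (simp add: tiles_at_def)
  then have "s *\<^sub>R (\<delta> *\<^sub>R x) \<in> corner_cone (first_edge t v) (second_edge t v)"
    using tile_corner_region_subset tiles_at_edges t by blast
  then have "x \<in> corner_cone (first_edge t v) (second_edge t v)"
    using s assms(2) by (simp add: corner_cone_def wedge_simps zero_le_mult_iff mult_le_0_iff not_le[symmetric])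
  then show ?thesis using \<open>t \<in> tiles_at v\<close> by blast
qed

end

section \<open>Discrete holomorphic functions and the network\<close>

context convex_tiling
begin

text \<open>This selects a tile on a chosen side of \<open>x\<close>. A cone that misses
  \<open>x\<close> is closed and misses the perturbed directions for small \<open>\<eta>\<close>; as
  there are finitely many tiles, some cone through \<open>x\<close> must catch one of them.\<close>

lemma cone_cover_side:
  assumes "v \<in> tiling_vertices T"
    and "\<forall>\<^sub>F \<eta> in at_right 0. \<exists>\<delta>>0. v + \<delta> *\<^sub>R (x + \<eta> *\<^sub>R y) \<in> R"
  obtains t \<eta> where "t \<in> tiles_at v" "x \<in> corner_cone (first_edge t v) (second_edge t v)"
    "\<eta> > 0" "x + \<eta> *\<^sub>R y \<in> corner_cone (first_edge t v) (second_edge t v)"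
proof (rule ccontr)
  let ?C = "\<lambda>t. corner_cone (first_edge t v) (second_edge t v)"
  note witness = that
  assume "\<not> thesis"
  then have no: "x + \<eta> *\<^sub>R y \<notin> ?C t" if "t \<in> tiles_at v" "x \<in> ?C t" "\<eta> > 0" for t \<eta>
    using witness[OF that(1,2,3)] \<open>\<not> thesis\<close> by blast
  have "\<forall>\<^sub>F \<eta> in at_right 0. x + \<eta> *\<^sub>R y \<notin> ?C t" if t: "t \<in> tiles_at v" for t
  proof (cases "x \<in> ?C t")
    case True
    then have "x + \<eta> *\<^sub>R y \<notin> ?C t" if "\<eta> > 0" for \<eta>
      using no t that by blast
    then show ?thesis
      using eventually_at_right_less[of "0::real"] by (auto elim: eventually_mono)
  next
    case False
    have "((\<lambda>\<eta>. x + \<eta> *\<^sub>R y) \<longlongrightarrow> x) (at_right 0)"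
      by (auto intro!: tendsto_eq_intros)
    then have "\<forall>\<^sub>F \<eta> in at_right 0. x + \<eta> *\<^sub>R y \<in> - ?C t"
      using False closed_corner_cone by (intro topological_tendstoD) auto
    then show ?thesis by simp
  qed
  then have "\<forall>\<^sub>F \<eta> in at_right 0. \<forall>t\<in>tiles_at v. x + \<eta> *\<^sub>R y \<notin> ?C t"
    by (intro eventually_ball_finite finite_tiles_at) auto
  with assms(2) have "\<forall>\<^sub>F \<eta> in at_right (0::real). False"
    by eventually_elim (use cone_cover[OF assms(1)] in blast)
  then show False by (simp add: trivial_limit_at_right_real)
qed

lemma unit_in_cone_parallel:
  assumes "cmod u = 1" "cmod w = 1" "cmod x = 1" "wedge u w > 0" "x \<in> corner_cone u w"
  shows "wedge u x = 0 \<Longrightarrow> x = u" "wedge x w = 0 \<Longrightarrow> x = w"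
proof -
  assume "wedge u x = 0"
  then have "u = x \<or> u = - x" using assms unit_parallel by blast
  then show "x = u"
    using assms by (auto simp: corner_cone_def wedge_simps)
next
  assume "wedge x w = 0"
  then have "x = w \<or> x = - w" using assms unit_parallel by blast
  then show "x = w"
    using assms by (auto simp: corner_cone_def wedge_simps)
qed

lemma tile_cornerD:
  "tile_corner t v u w \<Longrightarrow> cmod u = 1" "tile_corner t v u w \<Longrightarrow> cmod w = 1"
  "tile_corner t v u w \<Longrightarrow> wedge u w > 0"
  by (simp_all add: tile_corner_def)

lemma edges_in_cone:
  "wedge u w > 0 \<Longrightarrow> u \<in> corner_cone u w" "wedge u w > 0 \<Longrightarrow> w \<in> corner_cone u w"
  by (simp_all add: corner_cone_def wedge_self)

text \<open>Multiplication by \<open>- \<i>\<close> turns clockwise, so the perturbed direction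
  leaves \<open>t\<close> across its first edge \<open>u\<close>. The tile found there is a
  different one, has \<open>u\<close> on the rim of its cone, and cannot have \<open>u\<close> as
  its first edge.\<close>

lemma match_first_edge:
  assumes t: "t \<in> tiles_at v" and u: "u = first_edge t v"
    and ev: "\<forall>\<^sub>F \<eta> in at_right 0. \<exists>\<delta>>0. v + \<delta> *\<^sub>R (u + \<eta> *\<^sub>R (- \<i> * u)) \<in> R"
  shows "\<exists>t'\<in>tiles_at v. second_edge t' v = u"
proof -
  have tc: "tile_corner t v u (second_edge t v)"
    using tiles_at_edges[OF t] u by simp
  have v: "v \<in> tiling_vertices T" using t by (auto simp: tiles_at_def tiling_vertices_def)
  have neg: "wedge u (u + \<eta> *\<^sub>R (- \<i> * u)) < 0" if "\<eta> > 0" for \<eta>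
  proof -
    have "wedge u (- \<i> * u) = - (cmod u)\<^sup>2"
      unfolding wedge_def cmod_power2 by (simp add: power2_eq_square)
    then show ?thesis
      using that tile_cornerD(1)[OF tc] by (simp only: wedge_simps) simp
  qed
  obtain t' \<eta> where t': "t' \<in> tiles_at v" "u \<in> corner_cone (first_edge t' v) (second_edge t' v)"
    "\<eta> > 0" "u + \<eta> *\<^sub>R (- \<i> * u) \<in> corner_cone (first_edge t' v) (second_edge t' v)"
    using cone_cover_side[OF v ev] .
  note tc' = tiles_at_edges[OF t'(1)]
  have nu: "first_edge t' v \<noteq> u"
    using t'(4) neg[OF t'(3)] by (auto simp: corner_cone_def)
  then have "t \<noteq> t'" using u by auto
  then have "wedge (first_edge t' v) u = 0 \<or> wedge u (second_edge t' v) = 0"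
    using direction_on_edge[OF _ _ _ tc' tc t'(2)] edges_in_cone tile_cornerD[OF tc] t t'(1)
    by (auto simp: tiles_at_def)
  then have "u = first_edge t' v \<or> u = second_edge t' v"
    using unit_in_cone_parallel[OF _ _ _ _ t'(2)] tile_cornerD[OF tc'] tile_cornerD[OF tc] by blast
  then show ?thesis using nu t'(1) by auto
qed

lemma match_second_edge:
  assumes t: "t \<in> tiles_at v" and w: "w = second_edge t v"
    and ev: "\<forall>\<^sub>F \<eta> in at_right 0. \<exists>\<delta>>0. v + \<delta> *\<^sub>R (w + \<eta> *\<^sub>R (\<i> * w)) \<in> R"
  shows "\<exists>t'\<in>tiles_at v. first_edge t' v = w"
proof -
  have tc: "tile_corner t v (first_edge t v) w"
    using tiles_at_edges[OF t] w by simp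
  have v: "v \<in> tiling_vertices T" using t by (auto simp: tiles_at_def tiling_vertices_def)
  have neg: "wedge (w + \<eta> *\<^sub>R (\<i> * w)) w < 0" if "\<eta> > 0" for \<eta>
  proof -
    have "wedge (\<i> * w) w = - (cmod w)\<^sup>2"
      unfolding wedge_def cmod_power2 by (simp add: power2_eq_square)
    then show ?thesis
      using that tile_cornerD(2)[OF tc] by (simp only: wedge_simps) simp
  qed
  obtain t' \<eta> where t': "t' \<in> tiles_at v" "w \<in> corner_cone (first_edge t' v) (second_edge t' v)"
    "\<eta> > 0" "w + \<eta> *\<^sub>R (\<i> * w) \<in> corner_cone (first_edge t' v) (second_edge t' v)"
    using cone_cover_side[OF v ev] .
  note tc' = tiles_at_edges[OF t'(1)]
  have nw: "second_edge t' v \<noteq> w"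
    using t'(4) neg[OF t'(3)] by (auto simp: corner_cone_def)
  then have "t \<noteq> t'" using w by auto
  then have "wedge (first_edge t' v) w = 0 \<or> wedge w (second_edge t' v) = 0"
    using direction_on_edge[OF _ _ _ tc' tc t'(2)] edges_in_cone tile_cornerD[OF tc] t t'(1)
    by (auto simp: tiles_at_def)
  then have "w = first_edge t' v \<or> w = second_edge t' v"
    using unit_in_cone_parallel[OF _ _ _ _ t'(2)] tile_cornerD[OF tc'] tile_cornerD[OF tc] by blast
  then show ?thesis using nw t'(1) by auto
qed

lemma small_perturbation:
  fixes b c :: real
  assumes "c > 0"
  obtains \<eta> where "\<eta> > 0" "c + \<eta> * b > 0"
proof
  show "c / (2 * (1 + \<bar>b\<bar>)) > 0" using assms by simp
  have "\<bar>c / (2 * (1 + \<bar>b\<bar>)) * b\<bar> = (c / 2) * (\<bar>b\<bar> / (1 + \<bar>b\<bar>))"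
    using assms by (simp add: abs_mult)
  also have "\<dots> \<le> (c / 2) * 1"
    using assms by (intro mult_left_mono) auto
  finally show "c + c / (2 * (1 + \<bar>b\<bar>)) * b > 0" using assms by linarith
qed

text \<open>Two tiles sharing the first edge \<open>u\<close> would overlap:
  \<open>u + \<eta> *\<^sub>R w\<close> is strictly inside both cones for small
  \<open>\<eta> > 0\<close>.\<close>

lemma inj_on_first_edge: "inj_on (\<lambda>t. first_edge t v) (tiles_at v)"
proof (rule inj_onI, rule ccontr)
  fix t t' assume t: "t \<in> tiles_at v" "t' \<in> tiles_at v" "first_edge t v = first_edge t' v" "t \<noteq> t'"
  define u w w' where "u = first_edge t v" and "w = second_edge t v" and "w' = second_edge t' v"
  have tc: "tile_corner t v u w" "tile_corner t' v u w'"
    using tiles_at_edges[OF t(1)] tiles_at_edges[OF t(2)] t(3) by (simp_all add: u_def w_def w'_def)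
  obtain \<eta> where \<eta>: "\<eta> > 0" "wedge u w' + \<eta> * wedge w w' > 0"
    using small_perturbation tile_cornerD(3)[OF tc(2)] by blast
  show False
    by (rule open_cones_disjoint[OF _ _ t(4) tc, of "u + \<eta> *\<^sub>R w"])
      (use t \<eta> tile_cornerD(3)[OF tc(1)] tile_cornerD(3)[OF tc(2)] in \<open>auto simp: wedge_simps tiles_at_def\<close>)
qed

lemma inj_on_second_edge: "inj_on (\<lambda>t. second_edge t v) (tiles_at v)"
proof (rule inj_onI, rule ccontr)
  fix t t' assume t: "t \<in> tiles_at v" "t' \<in> tiles_at v" "second_edge t v = second_edge t' v" "t \<noteq> t'"
  define u w u' where "u = first_edge t v" and "w = second_edge t v" and "u' = first_edge t' v"
  have tc: "tile_corner t v u w" "tile_corner t' v u' w"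
    using tiles_at_edges[OF t(1)] tiles_at_edges[OF t(2)] t(3) by (simp_all add: u_def w_def u'_def)
  obtain \<eta> where \<eta>: "\<eta> > 0" "wedge u' w + \<eta> * wedge u' u > 0"
    using small_perturbation tile_cornerD(3)[OF tc(2)] by blast
  show False
    by (rule open_cones_disjoint[OF _ _ t(4) tc, of "w + \<eta> *\<^sub>R u"])
      (use t \<eta> tile_cornerD(3)[OF tc(1)] tile_cornerD(3)[OF tc(2)] in \<open>auto simp: wedge_simps tiles_at_def\<close>)
qed

lemma tile_sum_telescope:
  fixes F :: "complex \<Rightarrow> complex"
  shows "(\<Sum>t\<in>tiles_at v. F (v + second_edge t v) - F (v + first_edge t v)) =
    (\<Sum>d\<in>(\<lambda>t. second_edge t v) ` tiles_at v. F (v + d)) -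
    (\<Sum>d\<in>(\<lambda>t. first_edge t v) ` tiles_at v. F (v + d))"
  by (simp add: sum_subtractf sum.reindex[OF inj_on_first_edge] sum.reindex[OF inj_on_second_edge])

lemma interior_direction:
  assumes "v \<in> interior R"
  shows "\<exists>\<delta>>0. v + \<delta> *\<^sub>R x \<in> R"
proof -
  obtain e where e: "e > 0" "ball v e \<subseteq> R" using assms mem_interior by blast
  have "norm ((e / (2 * (1 + norm x))) *\<^sub>R x) = (e / 2) * (norm x / (1 + norm x))"
    using e(1) by (simp add: abs_mult)
  also have "\<dots> \<le> (e / 2) * 1"
    using e(1) by (intro mult_left_mono) (auto simp: divide_le_eq add_pos_nonneg)
  finally have "norm ((e / (2 * (1 + norm x))) *\<^sub>R x) < e" using e(1) by linarith
  then have "v + (e / (2 * (1 + norm x))) *\<^sub>R x \<in> R" using e(2) by (auto simp: dist_norm)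
  moreover have "e / (2 * (1 + norm x)) > 0" using e(1) by (simp add: add_pos_nonneg)
  ultimately show ?thesis by blast
qed

lemma interior_sum_zero:
  fixes F :: "complex \<Rightarrow> complex"
  assumes "v \<in> interior R"
  shows "(\<Sum>t\<in>tiles_at v. F (v + second_edge t v) - F (v + first_edge t v)) = 0"
proof -
  have "(\<lambda>t. second_edge t v) ` tiles_at v = (\<lambda>t. first_edge t v) ` tiles_at v"
  proof (intro equalityI image_subsetI)
    fix t assume "t \<in> tiles_at v"
    then show "second_edge t v \<in> (\<lambda>t. first_edge t v) ` tiles_at v"
      using match_second_edge[OF _ refl always_eventually, of t v] interior_direction[OF assms]
      by (simp only: image_iff eq_commute[of "second_edge t v"]) blast
  next
    fix t assume "t \<in> tiles_at v"
    then show "first_edge t v \<in> (\<lambda>t. second_edge t v) ` tiles_at v"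
      using match_first_edge[OF _ refl always_eventually, of t v] interior_direction[OF assms]
      by (simp only: image_iff eq_commute[of "first_edge t v"]) blast
  qed
  then show ?thesis by (simp add: tile_sum_telescope)
qed

section \<open>Discrete Cauchy-Riemann equations and currents\<close>

definition disc_holomorphic :: "(complex \<Rightarrow> complex) \<Rightarrow> bool" where
  "disc_holomorphic F \<longleftrightarrow> (\<forall>t\<in>T. \<forall>v u w. tile_corner t v u w \<longrightarrow>
     (F (v + w) - F (v + u)) * (u + w) = (F (v + u + w) - F v) * (w - u))"

text \<open>As the sides have equal length, \<open>(w - u) * cnj (u + w)\<close> has no real part;
  its imaginary part \<open>2 * wedge u w\<close> is positive and fixes the ratio.\<close>

lemma rhombus_diagonals:
  assumes "cmod u = 1" "cmod w = 1" "wedge u w > 0"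
  shows "u + w \<noteq> 0" "w - u = \<i> * of_real (cmod (w - u) / cmod (u + w)) * (u + w)"
proof -
  show nz: "u + w \<noteq> 0"
  proof
    assume "u + w = 0"
    then have "w = - u" by (simp add: eq_neg_iff_add_eq_0 add.commute)
    then show False using assms by (simp add: wedge_simps)
  qed
  define k where "k = 2 * wedge u w / (cmod (u + w))\<^sup>2"
  have k: "k > 0" using assms nz by (simp add: k_def)
  have n: "u * cnj u = 1" "w * cnj w = 1"
    using assms by (simp_all add: complex_norm_square[symmetric])
  have "(w - u) * cnj (u + w) = w * cnj u - u * cnj w + (w * cnj w - u * cnj u)"
    by (simp add: algebra_simps)
  also have "\<dots> = \<i> * of_real (2 * wedge u w)"
    unfolding n by (rule complex_eqI) (simp_all add: wedge_def)
  finally have "(w - u) * (cnj (u + w) * (u + w)) = \<i> * of_real (2 * wedge u w) * (u + w)"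
    by (simp add: mult.assoc)
  then have "(w - u) * of_real ((cmod (u + w))\<^sup>2) = \<i> * of_real (2 * wedge u w) * (u + w)"
    by (simp only: complex_norm_square mult.commute[of "cnj (u + w)"])
  then have e: "w - u = \<i> * of_real k * (u + w)"
    using nz by (simp add: k_def field_simps)
  then have "cmod (w - u) = k * cmod (u + w)"
    using k by (simp add: norm_mult)
  then have "k = cmod (w - u) / cmod (u + w)" using nz by simp
  then show "w - u = \<i> * of_real (cmod (w - u) / cmod (u + w)) * (u + w)" using e by simp
qed

text \<open>The diagonals being perpendicular, the difference of \<open>Re F\<close> along one,
  times the ratio of lengths, is the difference of \<open>Im F\<close> along the other. For black
  \<open>v\<close> the ratio is the conductance, so \<open>Im F\<close> acts as the harmonic
  conjugate.\<close>

lemma disc_holomorphic_flux: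
  assumes "disc_holomorphic F" "t \<in> T" "tile_corner t v u w"
  shows "cmod (w - u) / cmod (u + w) * (Re (F (v + u + w)) - Re (F v)) = Im (F (v + w) - F (v + u))"
proof -
  note d = rhombus_diagonals[OF tile_cornerD[OF assms(3)]]
  define k where "k = cmod (w - u) / cmod (u + w)"
  have "(F (v + w) - F (v + u)) * (u + w) = (F (v + u + w) - F v) * (\<i> * of_real k * (u + w))"
    using assms d(2) unfolding disc_holomorphic_def k_def by metis
  then have "F (v + w) - F (v + u) = (F (v + u + w) - F v) * (\<i> * of_real k)"
    using d(1) by (simp flip: mult.assoc)
  then show ?thesis by (simp add: k_def[symmetric])
qed

end

lemma black_white_diag:
  assumes "proper_coloring T col" "t \<in> T" "tile_corner t v u w" "col v"
  shows "{fst (black_diag col t), snd (black_diag col t)} = {v, v + u + w}"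
    "{fst (white_diag col t), snd (white_diag col t)} = {v + u, v + w}"
    "col (v + u + w)" "\<not> col (v + u)" "\<not> col (v + w)"
proof -
  obtain A B C D where t: "t = (A,B,C,D)" by (cases t)
  have c: "col A = col C" "col B = col D" "col A \<noteq> col B"
    using assms(1,2) by (auto simp: proper_coloring_def t)
  have *: "({v, v + u + w} = {A,C} \<and> {v + u, v + w} = {B,D}) \<or>
        ({v, v + u + w} = {B,D} \<and> {v + u, v + w} = {A,C})"
    using assms(3) by (simp add: tile_corner_def t)
  have all: "{fst (black_diag col t), snd (black_diag col t)} = {v, v + u + w} \<and>
    {fst (white_diag col t), snd (white_diag col t)} = {v + u, v + w} \<and>
    col (v + u + w) \<and> \<not> col (v + u) \<and> \<not> col (v + w)"
    using *
  proof (elim disjE conjE)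
    assume 1: "{v, v + u + w} = {A,C}" "{v + u, v + w} = {B,D}"
    then have "col A" using assms(4) c by (metis doubleton_eq_iff)
    then show ?thesis using 1 c by (auto simp: black_diag_def white_diag_def t doubleton_eq_iff)
  next
    assume 1: "{v, v + u + w} = {B,D}" "{v + u, v + w} = {A,C}"
    then have "col B" using assms(4) c by (metis doubleton_eq_iff)
    then show ?thesis using 1 c by (auto simp: black_diag_def white_diag_def t doubleton_eq_iff)
  qed
  then show "{fst (black_diag col t), snd (black_diag col t)} = {v, v + u + w}"
    "{fst (white_diag col t), snd (white_diag col t)} = {v + u, v + w}"
    "col (v + u + w)" "\<not> col (v + u)" "\<not> col (v + w)"
    by blast+
qed

lemma diag_len_doubleton:
  "{fst e, snd e} = {a, b} \<Longrightarrow> diag_len e = cmod (b - a)"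
  by (auto simp: diag_len_def doubleton_eq_iff norm_minus_commute)

lemma diag_ratio:
  assumes "proper_coloring T col" "t \<in> T" "tile_corner t v u w" "col v"
  shows "diag_len (white_diag col t) / diag_len (black_diag col t) = cmod (w - u) / cmod (u + w)"
  using diag_len_doubleton[OF black_white_diag(1)[OF assms]]
    diag_len_doubleton[OF black_white_diag(2)[OF assms]] by simp

context convex_tiling
begin

definition tile_conductance :: "rhomb \<Rightarrow> complex \<Rightarrow> real" where
  "tile_conductance t v = cmod (second_edge t v - first_edge t v) / cmod (first_edge t v + second_edge t v)"

lemma tile_conductance_pos:
  assumes "t \<in> tiles_at v" shows "tile_conductance t v > 0"
proof -
  note tc = tile_cornerD[OF tiles_at_edges[OF assms]]
  have "first_edge t v \<noteq> second_edge t v" using tc(3) by (auto simp: wedge_self)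
  then show ?thesis
    using rhombus_diagonals(1)[OF tc] by (simp add: tile_conductance_def)
qed

definition opposite :: "rhomb \<Rightarrow> complex \<Rightarrow> complex" where
  "opposite t v = v + first_edge t v + second_edge t v"

lemma opposite_black:
  assumes "proper_coloring T col" "col v" "t \<in> tiles_at v"
  shows "opposite t v \<in> black_vertices T col"
  using black_white_diag(3)[OF assms(1) _ tiles_at_edges assms(2)] assms(3)
    tile_corner_corners[OF tiles_at_edges[OF assms(3)]]
  by (auto simp: opposite_def black_vertices_def tiling_vertices_def tiles_at_def)

lemma finite_black: "finite (black_vertices T col)"
proof -
  have "finite (corners t)" for t by (cases t) (simp add: corners_def)
  then show ?thesis
    using finite_T by (simp add: black_vertices_def tiling_vertices_def)
qed

lemma black_diag_iff:
  assumes "proper_coloring T col" "col v" "t \<in> T"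
  shows "black_diag col t = (v, y) \<or> black_diag col t = (y, v) \<longleftrightarrow> t \<in> tiles_at v \<and> opposite t v = y"
proof
  assume *: "black_diag col t = (v, y) \<or> black_diag col t = (y, v)"
  then have "v \<in> corners t"
    by (cases t) (auto simp: black_diag_def corners_def split: if_splits)
  then have t: "t \<in> tiles_at v" using assms(3) by (simp add: tiles_at_def)
  have "{fst (black_diag col t), snd (black_diag col t)} = {v, opposite t v}"
    using black_white_diag(1)[OF assms(1,3) tiles_at_edges[OF t] assms(2)] by (simp add: opposite_def)
  then have "{v, y} = {v, opposite t v}" using * by (elim disjE) (simp_all add: insert_commute)
  then have "opposite t v = y" by (auto simp: doubleton_eq_iff)
  then show "t \<in> tiles_at v \<and> opposite t v = y" using t by simp
next
  assume *: "t \<in> tiles_at v \<and> opposite t v = y"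
  then have "{fst (black_diag col t), snd (black_diag col t)} = {v, y}"
    using black_white_diag(1)[OF assms(1,3) tiles_at_edges assms(2)] by (simp add: opposite_def)
  then show "black_diag col t = (v, y) \<or> black_diag col t = (y, v)"
    by (cases "black_diag col t") (auto simp: doubleton_eq_iff)
qed

text \<open>The definition sums over vertices, and each conductance over tiles; grouping the tiles
  at \<open>v\<close> by their opposite corner merges the two sums.\<close>

lemma current_out_eq:
  assumes "proper_coloring T col" "col v"
  shows "current_out T col f v = (\<Sum>t\<in>tiles_at v. tile_conductance t v * (f (opposite t v) - f v))"
proof -
  have "conductance T col v y * (f y - f v) =
    (\<Sum>t\<in>{t \<in> tiles_at v. opposite t v = y}. tile_conductance t v * (f (opposite t v) - f v))" for y
  proof -
    have "{t \<in> T. black_diag col t = (v, y) \<or> black_diag col t = (y, v)} = {t \<in> tiles_at v. opposite t v = y}"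
    proof (intro Collect_cong)
      fix t
      show "(t \<in> T \<and> (black_diag col t = (v, y) \<or> black_diag col t = (y, v))) =
          (t \<in> tiles_at v \<and> opposite t v = y)"
        using black_diag_iff[OF assms, of t y] by (cases "t \<in> T") (simp_all add: tiles_at_def)
    qed
    moreover have "diag_len (white_diag col t) / diag_len (black_diag col t) = tile_conductance t v"
      if "t \<in> tiles_at v" for t
      using diag_ratio[OF assms(1) _ tiles_at_edges[OF that] assms(2)] that
      by (simp add: tile_conductance_def tiles_at_def)
    ultimately show ?thesis
      unfolding conductance_def sum_distrib_right by (intro sum.cong) simp_all
  qed
  moreover have "(\<lambda>t. opposite t v) ` tiles_at v \<subseteq> black_vertices T col"
    using opposite_black[OF assms] by (rule image_subsetI)
  ultimately show ?thesis
    unfolding current_out_def by (simp only: sum.group[OF finite_tiles_at finite_black])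
qed

lemma current_out_disc_holomorphic:
  assumes "proper_coloring T col" "v \<in> black_vertices T col" "disc_holomorphic F"
    and f: "\<And>x. x \<in> black_vertices T col \<Longrightarrow> f x = Re (F x)"
  shows "current_out T col f v =
    Im (\<Sum>t\<in>tiles_at v. F (v + second_edge t v) - F (v + first_edge t v))"
proof -
  have v: "col v" using assms by (simp add: black_vertices_def)
  have "tile_conductance t v * (f (opposite t v) - f v) =
    Im (F (v + second_edge t v) - F (v + first_edge t v))" if t: "t \<in> tiles_at v" for t
  proof -
    have "t \<in> T" using t by (simp add: tiles_at_def)
    from disc_holomorphic_flux[OF assms(3) this tiles_at_edges[OF t]]
    show ?thesis
      using f assms(2) opposite_black[OF assms(1) v t]
      by (simp add: tile_conductance_def opposite_def)
  qed
  then show ?thesis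
    unfolding current_out_eq[OF assms(1) v] Im_sum by (rule sum.cong[OF refl])
qed

text \<open>Every interior vertex has a black neighbour with strictly larger real part, so among the
  vertices where the maximum is attained the rightmost one must lie on the boundary.\<close>

lemma maximum_principle:
  assumes col: "proper_coloring T col"
    and harm: "\<And>x. x \<in> black_vertices T col - boundary_black T col R \<Longrightarrow> current_out T col f x = 0"
    and bd: "\<And>x. x \<in> boundary_black T col R \<Longrightarrow> f x \<le> 0"
    and y: "y \<in> black_vertices T col"
  shows "f y \<le> 0"
proof (rule ccontr)
  assume "\<not> f y \<le> 0"
  let ?B = "black_vertices T col"
  define M where "M = Max (f ` ?B)"
  have M: "f x \<le> M" if "x \<in> ?B" for x
    unfolding M_def using that finite_black by simp
  have "M > 0" using M[OF y] \<open>\<not> f y \<le> 0\<close> by linarith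
  have "M \<in> f ` ?B" unfolding M_def using y finite_black by (intro Max_in) auto
  then have ne: "{x \<in> ?B. f x = M} \<noteq> {}" by auto
  have fin: "finite {x \<in> ?B. f x = M}" using finite_black by simp
  define m where "m = Max (Re ` {x \<in> ?B. f x = M})"
  have m: "Re x \<le> m" if "x \<in> ?B" "f x = M" for x
    unfolding m_def using that fin by (intro Max_ge) auto
  have "m \<in> Re ` {x \<in> ?B. f x = M}" unfolding m_def using fin ne by (intro Max_in) auto
  then obtain x where x: "x \<in> ?B" "f x = M" "Re x = m" by auto
  then have cx: "col x" and xv: "x \<in> tiling_vertices T" by (auto simp: black_vertices_def)
  have nb: "x \<notin> boundary_black T col R" using bd x \<open>M > 0\<close> by force
  have xR: "x \<in> R" using xv corner_in_region by (auto simp: tiling_vertices_def)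
  have "x \<in> interior R"
    using nb x xR closure_subset[of R] by (auto simp: boundary_black_def frontier_def)
  then obtain \<delta> where "\<delta> > 0" "x + \<delta> *\<^sub>R 1 \<in> R" using interior_direction by blast
  then obtain t where t: "t \<in> tiles_at x" "1 \<in> corner_cone (first_edge t x) (second_edge t x)"
    using cone_cover[OF xv] by blast
  have "(\<Sum>t\<in>tiles_at x. tile_conductance t x * (f x - f (opposite t x))) = 0"
  proof -
    have "current_out T col f x = 0" using harm x nb by blast
    then have "(\<Sum>t\<in>tiles_at x. - (tile_conductance t x * (f (opposite t x) - f x))) = 0"
      unfolding current_out_eq[OF col cx] sum_negf by simp
    then show ?thesis by (simp add: algebra_simps)
  qed
  moreover have "tile_conductance t x * (f x - f (opposite t x)) \<ge> 0" if "t \<in> tiles_at x" for t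
    using tile_conductance_pos[OF that] M[OF opposite_black[OF col cx that]] x(2)
    by (intro mult_nonneg_nonneg) auto
  ultimately have "tile_conductance t x * (f x - f (opposite t x)) = 0"
    using t(1) sum_nonneg_eq_0_iff[OF finite_tiles_at] by (metis (no_types, lifting))
  then have "f (opposite t x) = M"
    using tile_conductance_pos[OF t(1)] x(2) by simp
  then have le: "Re (opposite t x) \<le> Re x"
    using m opposite_black[OF col cx t(1)] x(3) by blast
  define u w where "u = first_edge t x" and "w = second_edge t x"
  note tc = tile_cornerD[OF tiles_at_edges[OF t(1)], folded u_def w_def]
  define \<alpha> \<beta> where "\<alpha> = wedge 1 w / wedge u w" and "\<beta> = wedge u 1 / wedge u w"
  have one: "1 = \<alpha> *\<^sub>R u + \<beta> *\<^sub>R w"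
    unfolding \<alpha>_def \<beta>_def using tc by (intro wedge_coordinates) auto
  have ab: "\<alpha> \<ge> 0" "\<beta> \<ge> 0"
    using t(2) tc(3) by (auto simp: \<alpha>_def \<beta>_def corner_cone_def u_def w_def)
  have "\<alpha> \<noteq> 0 \<or> \<beta> \<noteq> 0" using one by auto
  then have "\<alpha> + \<beta> > 0" using ab by linarith
  \<comment> \<open>With \<open>c\<close> the cosine of the tile's angle, the direction
    \<open>1 = \<alpha> u + \<beta> w\<close> has inner product
    \<open>(\<alpha> + \<beta>) * (1 + c)\<close> with the diagonal \<open>u + w\<close>, so the
    opposite corner lies strictly to the right.\<close>
  define c where "c = u \<bullet> w"
  have c: "c > - 1"
  proof -
    have "0 < (cmod (u + w))\<^sup>2" using rhombus_diagonals(1)[OF tc] by simp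
    also have "\<dots> = 2 + 2 * c"
      using tc unfolding c_def by (simp add: power2_norm_eq_inner inner_add_left inner_add_right inner_commute norm_eq_1)
    finally show ?thesis by simp
  qed
  have "Re (u + w) = 1 \<bullet> (u + w)" by (simp add: inner_complex_def)
  also have "\<dots> = (\<alpha> *\<^sub>R u + \<beta> *\<^sub>R w) \<bullet> (u + w)" using one by simp
  also have "\<dots> = (\<alpha> + \<beta>) * (1 + c)"
    using tc unfolding c_def by (simp add: inner_add_left inner_add_right inner_commute norm_eq_1 algebra_simps)
  also have "\<dots> > 0" using \<open>\<alpha> + \<beta> > 0\<close> c by simp
  finally show False using le by (simp add: opposite_def u_def w_def)
qed

lemma current_out_diff:
  "current_out T col (\<lambda>x. f x - g x) v = current_out T col f v - current_out T col g v"
  unfolding current_out_def by (simp add: sum_subtractf[symmetric] algebra_simps)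

lemma dirichlet_unique:
  assumes col: "proper_coloring T col"
    and "\<And>x. x \<in> black_vertices T col - boundary_black T col R \<Longrightarrow> current_out T col f x = 0"
    and "\<And>x. x \<in> black_vertices T col - boundary_black T col R \<Longrightarrow> current_out T col g x = 0"
    and "\<And>x. x \<in> boundary_black T col R \<Longrightarrow> f x = g x"
    and "y \<in> black_vertices T col"
  shows "f y = g y"
proof -
  have "f y - g y \<le> 0"
    by (rule maximum_principle[OF col]) (use assms in \<open>auto simp: current_out_diff\<close>)
  moreover have "g y - f y \<le> 0"
    by (rule maximum_principle[OF col]) (use assms in \<open>auto simp: current_out_diff\<close>)
  ultimately show ?thesis by simp
qed

lemma dirichlet_potential_eqI:
  assumes col: "proper_coloring T col" and b: "b \<in> boundary_black T col R"
    and u: "u b = 1" "\<And>v. v \<in> boundary_black T col R \<Longrightarrow> v \<noteq> b \<Longrightarrow> u v = 0"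
      "\<And>x. x \<in> black_vertices T col - boundary_black T col R \<Longrightarrow> current_out T col u x = 0"
      "\<And>x. x \<notin> black_vertices T col \<Longrightarrow> u x = 0"
  shows "dirichlet_potential T col R b = u"
  unfolding dirichlet_potential_def
proof (rule the_equality)
  fix u' assume u': "u' b = 1 \<and> (\<forall>v\<in>boundary_black T col R. v \<noteq> b \<longrightarrow> u' v = 0) \<and>
     (\<forall>x\<in>black_vertices T col - boundary_black T col R. current_out T col u' x = 0) \<and>
     (\<forall>x. x \<notin> black_vertices T col \<longrightarrow> u' x = 0)"
  show "u' = u"
  proof
    fix y show "u' y = u y"
    proof (cases "y \<in> black_vertices T col")
      case True
      show ?thesis
        by (rule dirichlet_unique[OF col _ _ _ True]) (use u u' in \<open>auto\<close>, metis)
    qed (use u u' in auto)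
  qed
qed (use u in auto)

end

section \<open>Discrete exponentials\<close>

text \<open>Since the edges are nonzero, \<open>v\<close> is not confused with a neighbour, so the
  tile determines the pair of neighbours; the orientation then orders it.\<close>

lemma tile_corner_unique:
  assumes "tile_corner t v u w" "tile_corner t v u' w'"
  shows "u' = u \<and> w' = w"
proof -
  obtain A B C D where t: "t = (A,B,C,D)" by (cases t)
  have nz: "u \<noteq> 0" "w \<noteq> 0" "u' \<noteq> 0" "w' \<noteq> 0"
    using assms by (auto simp: tile_corner_def)
  have "({v, v + u + w} = {A,C} \<and> {v + u, v + w} = {B,D}) \<or>
        ({v, v + u + w} = {B,D} \<and> {v + u, v + w} = {A,C})"
    "({v, v + u' + w'} = {A,C} \<and> {v + u', v + w'} = {B,D}) \<or>
        ({v, v + u' + w'} = {B,D} \<and> {v + u', v + w'} = {A,C})"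
    using assms by (simp_all add: tile_corner_def t)
  then have "{v + u, v + w} = {v + u', v + w'} \<or> {v, v + u + w} = {v + u', v + w'}"
    by argo
  then have "{v + u, v + w} = {v + u', v + w'}"
    using nz by (auto simp: doubleton_eq_iff)
  then have "u = u' \<and> w = w' \<or> u = w' \<and> w = u'"
    by (auto simp: doubleton_eq_iff)
  moreover have "wedge u w > 0" "wedge u' w' > 0" using assms by (simp_all add: tile_corner_def)
  ultimately show ?thesis using wedge_commute[of u w] by auto
qed

section \<open>Edges of the tiling and multiplicative integration along them\<close>

context convex_tiling
begin

definition tile_edge :: "complex \<Rightarrow> complex \<Rightarrow> bool" where
  "tile_edge v e \<longleftrightarrow> (\<exists>t\<in>T. \<exists>u w. tile_corner t v u w \<and> (e = u \<or> e = w))"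

lemma tile_edgeI:
  "t \<in> T \<Longrightarrow> tile_corner t v u w \<Longrightarrow> tile_edge v u"
  "t \<in> T \<Longrightarrow> tile_corner t v u w \<Longrightarrow> tile_edge v w"
  unfolding tile_edge_def by blast+

lemma tile_corner_in_tiles_at: "t \<in> T \<Longrightarrow> tile_corner t v u w \<Longrightarrow> t \<in> tiles_at v"
  using tile_corner_corners by (simp add: tiles_at_def)

lemma tile_corner_vertices:
  assumes "t \<in> T" "tile_corner t v u w"
  shows "v \<in> tiling_vertices T" "v + u \<in> tiling_vertices T" "v + w \<in> tiling_vertices T"
    "v + u + w \<in> tiling_vertices T"
  using assms(1) tile_corner_corners[OF assms(2)] unfolding tiling_vertices_def by blast+

lemma tile_edge_vertices:
  assumes "tile_edge v e"
  shows "v \<in> tiling_vertices T" "v + e \<in> tiling_vertices T" "cmod e = 1"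
proof -
  obtain t u w where t: "t \<in> T" "tile_corner t v u w" "e = u \<or> e = w"
    using assms by (auto simp: tile_edge_def)
  show "v \<in> tiling_vertices T" "v + e \<in> tiling_vertices T" "cmod e = 1"
    using tile_corner_vertices[OF t(1,2)] tile_cornerD[OF t(2)] t(3) by auto
qed

lemma tile_edge_sym:
  assumes "tile_edge v e" shows "tile_edge (v + e) (- e)"
proof -
  obtain t u w where t: "t \<in> T" "tile_corner t v u w" "e = u \<or> e = w"
    using assms by (auto simp: tile_edge_def)
  note r1 = tile_corner_rotate[OF t(2)]
  note r3 = tile_corner_rotate[OF tile_corner_rotate[OF r1]]
  have "v + u + w + - u = v + w" by simp
  then show ?thesis
    using t(3) tile_edgeI(2)[OF t(1) r1] tile_edgeI(1)[OF t(1) r3] by auto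
qed

lemma tile_edge_at:
  assumes "tile_edge v e"
  obtains t where "t \<in> tiles_at v" "e = first_edge t v \<or> e = second_edge t v"
proof -
  obtain t u w where t: "t \<in> T" "tile_corner t v u w" "e = u \<or> e = w"
    using assms by (auto simp: tile_edge_def)
  have ta: "t \<in> tiles_at v" using tile_corner_in_tiles_at t by blast
  then have "first_edge t v = u \<and> second_edge t v = w"
    using tile_corner_unique[OF t(2) tiles_at_edges] by blast
  then show thesis using that ta t(3) by blast
qed

lemma finite_vertices: "finite (tiling_vertices T)"
proof -
  have "finite (corners t)" for t by (cases t) (simp add: corners_def)
  then show ?thesis
    using finite_T by (simp add: tiling_vertices_def)
qed

lemma closed_tile_region: "closed (tile_region t)"
  unfolding tile_region_def corners_def
  by (intro compact_imp_closed finite_imp_compact_convex_hull) (auto split: prod.splits)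

text \<open>The part of the region below \<open>x\<close> and near \<open>x\<close> is convex, hence connected, and is covered by
  the tiles at \<open>x\<close>; two of these that meet there share an edge going down from \<open>x\<close>.\<close>

lemma down_edges_agree:
  fixes \<tau> :: real and g :: "complex \<Rightarrow> 'b"
  defines "h \<equiv> \<lambda>z. Re z + \<tau> * Im z"
  assumes g: "\<And>t u w. \<lbrakk>t \<in> T; tile_corner t x u w; h u < 0; h w < 0\<rbrakk> \<Longrightarrow> g u = g w"
    and e: "tile_edge x e" "h e < 0" and e': "tile_edge x e'" "h e' < 0"
  shows "g e = g e'"
proof (rule ccontr)
  assume neq: "g e \<noteq> g e'"
  have hlin: "h (a + b) = h a + h b" "h (a - b) = h a - h b" "h (r *\<^sub>R a) = r * h a" for a b r
    by (simp_all add: h_def algebra_simps)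
  have x: "x \<in> tiling_vertices T" using e tile_edge_vertices by blast
  obtain \<epsilon> where \<epsilon>: "\<epsilon> > 0"
    "\<And>y. y \<in> R \<Longrightarrow> dist x y < \<epsilon> \<Longrightarrow> \<exists>t\<in>T. x \<in> corners t \<and> y \<in> tile_region t"
    using local_cover[OF x] by blast
  define S where "S = (R \<inter> {y. h y < h x}) \<inter> ball x \<epsilon>"
  have "convex {y. h y < h x}"
  proof -
    have "h y = Complex 1 \<tau> \<bullet> y" for y by (simp add: h_def inner_complex_def)
    then show ?thesis by (simp only: convex_halfspace_lt)
  qed
  then have "connected S"
    unfolding S_def using convex_region by (intro convex_connected convex_Int convex_ball)
  define dn where "dn t = {d \<in> {first_edge t x, second_edge t x}. h d < 0}" for t
  \<comment> \<open>The hypothesis makes \<open>g\<close> constant on the downward edges of each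
    tile, so the tiles having such edges split into those with the value \<open>g e\<close> and the
    others.\<close>
  define TA where "TA = {t \<in> tiles_at x. \<exists>d\<in>dn t. g d = g e}"
  define TB where "TB = {t \<in> tiles_at x. \<exists>d\<in>dn t. g d \<noteq> g e}"
  have dn_agree: "g d = g d'" if t: "t \<in> tiles_at x" and "d \<in> dn t" "d' \<in> dn t" for t d d'
  proof -
    have "t \<in> T" using t by (simp add: tiles_at_def)
    from g[OF this tiles_at_edges[OF t]] that(2,3) show ?thesis by (auto simp: dn_def)
  qed
  have meets: "(\<Union>t\<in>Q. tile_region t) \<inter> S \<noteq> {}" if Q: "t \<in> Q" "t \<in> tiles_at x" "d \<in> dn t" for Q t d
  proof -
    define s where "s = min 1 (\<epsilon> / 2)"
    have s: "s > 0" "s \<le> 1" "s < \<epsilon>" using \<epsilon>(1) by (auto simp: s_def)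
    have tc: "tile_corner t x (first_edge t x) (second_edge t x)" "t \<in> T"
      using tiles_at_edges Q by (simp_all add: tiles_at_def)
    have d: "cmod d = 1" "h d < 0" "d = first_edge t x \<or> d = second_edge t x"
      using Q(3) tile_cornerD[OF tc(1)] by (auto simp: dn_def)
    have "x \<in> tile_region t" "x + d \<in> tile_region t"
      using corners_subset_region[of t] tile_corner_corners[OF tc(1)] d(3) by auto
    then have "(1 - s) *\<^sub>R x + s *\<^sub>R (x + d) \<in> tile_region t"
      unfolding tile_region_def using s by (intro convexD convex_convex_hull) auto
    then have "x + s *\<^sub>R d \<in> tile_region t" by (simp add: algebra_simps)
    moreover from this have "x + s *\<^sub>R d \<in> S"
      using tc(2) region_eq d s by (auto simp: S_def hlin dist_norm mult_pos_neg)
    ultimately show ?thesis using Q(1) by blast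
  qed
  have dir: "\<exists>d\<in>{first_edge t x, second_edge t x}. d = n"
    if "t \<in> tiles_at x" "n \<in> corner_cone (first_edge t x) (second_edge t x)" "cmod n = 1"
      "wedge (first_edge t x) n = 0 \<or> wedge n (second_edge t x) = 0" for t n
    using unit_in_cone_parallel[OF tile_cornerD(1,2)[OF tiles_at_edges[OF that(1)]] that(3)
        tile_cornerD(3)[OF tiles_at_edges[OF that(1)]] that(2)] that(4) by auto
  let ?A = "\<Union>t\<in>TA. tile_region t" and ?B = "\<Union>t\<in>TB. tile_region t"
  have "closed ?A" "closed ?B"
    using finite_tiles_at[of x] by (auto intro!: closed_UN simp: TA_def TB_def closed_tile_region)
  \<comment> \<open>In the cone coordinates \<open>h (y - x)\<close> is a nonnegative combination of
    \<open>h u\<close> and \<open>h w\<close>, so a point below \<open>x\<close> forces one of the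
    two edges to go down.\<close>
  moreover have "S \<subseteq> ?A \<union> ?B"
  proof
    fix y assume y: "y \<in> S"
    then obtain t where t: "t \<in> T" "x \<in> corners t" "y \<in> tile_region t"
      using \<epsilon>(2)[of y] by (auto simp: S_def)
    then have ta: "t \<in> tiles_at x" by (simp add: tiles_at_def)
    define u w where "u = first_edge t x" and "w = second_edge t x"
    have tc: "tile_corner t x u w" using tiles_at_edges[OF ta] by (simp add: u_def w_def)
    have D: "wedge u w > 0" using tile_cornerD(3)[OF tc] .
    have c: "y - x \<in> corner_cone u w"
      by (rule tile_corner_region_subset[OF tc]) (use t in simp)
    have "y - x = (wedge (y - x) w / wedge u w) *\<^sub>R u + (wedge u (y - x) / wedge u w) *\<^sub>R w"
      using D by (intro wedge_coordinates) auto
    then have "h (y - x) = (wedge (y - x) w / wedge u w) * h u + (wedge u (y - x) / wedge u w) * h w"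
      using hlin by metis
    moreover have "h (y - x) < 0" using y by (simp add: S_def hlin)
    moreover have "wedge (y - x) w / wedge u w \<ge> 0" "wedge u (y - x) / wedge u w \<ge> 0"
      using c D by (auto simp: corner_cone_def)
    ultimately have "h u < 0 \<or> h w < 0"
      by (smt (verit) mult_nonneg_nonneg)
    then have "dn t \<noteq> {}" by (auto simp: dn_def u_def w_def)
    then have "t \<in> TA \<or> t \<in> TB" using ta by (auto simp: TA_def TB_def)
    then show "y \<in> ?A \<union> ?B" using t by blast
  qed
  moreover have "?A \<inter> ?B \<inter> S = {}"
  proof (rule ccontr)
    assume "?A \<inter> ?B \<inter> S \<noteq> {}"
    then obtain y t t' where y: "y \<in> S" and t: "t \<in> TA" "y \<in> tile_region t"
      and t': "t' \<in> TB" "y \<in> tile_region t'" by auto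
    obtain d d' where d: "t \<in> tiles_at x" "d \<in> dn t" "g d = g e"
      and d': "t' \<in> tiles_at x" "d' \<in> dn t'" "g d' \<noteq> g e"
      using t t' by (auto simp: TA_def TB_def)
    show False
    proof (cases "t = t'")
      case True
      then show False using dn_agree[OF d(1,2)] d d' by metis
    next
      case False
      \<comment> \<open>Two different tiles at \<open>x\<close> meet here only along a common edge:
        the unit vector \<open>n\<close> towards \<open>y\<close> is an edge of both and goes
        down.\<close>
      have hy: "h (y - x) < 0" using y by (simp add: S_def hlin)
      then have "y \<noteq> x" by (auto simp: h_def)
      define n where "n = inverse (cmod (y - x)) *\<^sub>R (y - x)"
      have n: "cmod n = 1" using \<open>y \<noteq> x\<close> by (simp add: n_def)
      have hn: "h n < 0" using hy \<open>y \<noteq> x\<close> by (simp add: n_def hlin mult_pos_neg)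
      have cone: "n \<in> corner_cone (first_edge s x) (second_edge s x)"
        if "s \<in> tiles_at x" "y \<in> tile_region s" for s
      proof -
        have "y - x \<in> corner_cone (first_edge s x) (second_edge s x)"
          by (rule tile_corner_region_subset[OF tiles_at_edges[OF that(1)]]) (use that in simp)
        then show ?thesis by (simp add: corner_cone_def n_def wedge_simps)
      qed
      have "n \<in> dn t"
        using dir[OF d(1) cone[OF d(1) t(2)] n] hn d(1) d'(1)
          direction_on_edge[OF _ _ False tiles_at_edges[OF d(1)] tiles_at_edges[OF d'(1)]
            cone[OF d(1) t(2)] cone[OF d'(1) t'(2)]]
        by (auto simp: dn_def tiles_at_def)
      moreover have "n \<in> dn t'"
        using dir[OF d'(1) cone[OF d'(1) t'(2)] n] hn d(1) d'(1)
          direction_on_edge[OF _ _ False[symmetric] tiles_at_edges[OF d'(1)] tiles_at_edges[OF d(1)]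
            cone[OF d'(1) t'(2)] cone[OF d(1) t(2)]]
        by (auto simp: dn_def tiles_at_def)
      ultimately show False
        using dn_agree[OF d(1,2)] dn_agree[OF d'(1,2)] d(3) d'(3) by metis
    qed
  qed
  moreover have "?A \<inter> S \<noteq> {}"
  proof -
    obtain t where "t \<in> tiles_at x" "e = first_edge t x \<or> e = second_edge t x"
      using tile_edge_at[OF e(1)] .
    then show ?thesis using e(2) by (intro meets[of t _ e]) (auto simp: TA_def dn_def)
  qed
  moreover have "?B \<inter> S \<noteq> {}"
  proof -
    obtain t where "t \<in> tiles_at x" "e' = first_edge t x \<or> e' = second_edge t x"
      using tile_edge_at[OF e'(1)] .
    then show ?thesis using e'(2) neq by (intro meets[of t _ e']) (auto simp: TB_def dn_def)
  qed
  ultimately show False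
    using \<open>connected S\<close> unfolding connected_closed by blast
qed

text \<open>Only finitely many slopes put two distinct vertices at the same height. A pair with
  \<open>Im (x - y) = 0\<close> merely adds the value 0 to the excluded set.\<close>

lemma generic_height:
  obtains \<tau> :: real where
    "\<And>x y. \<lbrakk>x \<in> tiling_vertices T; y \<in> tiling_vertices T; Re x + \<tau> * Im x = Re y + \<tau> * Im y\<rbrakk> \<Longrightarrow> x = y"
proof -
  let ?V = "tiling_vertices T"
  let ?bad = "(\<lambda>(x, y). - Re (x - y) / Im (x - y)) ` (?V \<times> ?V)"
  have "finite ?bad" using finite_vertices by blast
  then obtain \<tau> where \<tau>: "\<tau> \<notin> ?bad"
    using ex_new_if_finite[OF infinite_UNIV_char_0] by blast
  show thesis
  proof (rule that)
    fix x y assume xy: "x \<in> ?V" "y \<in> ?V" "Re x + \<tau> * Im x = Re y + \<tau> * Im y"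
    then have "- Re (x - y) / Im (x - y) \<in> ?bad" by force
    then have ne: "\<tau> \<noteq> - Re (x - y) / Im (x - y)" using \<tau> by metis
    have eq: "\<tau> * Im (x - y) = - Re (x - y)" using xy(3) by (simp add: algebra_simps)
    then have "Im (x - y) = 0" using ne by (metis nonzero_mult_div_cancel_right)
    then show "x = y" using eq by (intro complex_eqI) auto
  qed
qed

text \<open>The vertex added is always the highest so far, so its value is forced by any downward
  edge, and \<open>down_edges_agree\<close> reduces consistency to single tiles.\<close>

lemma multiplicative_potential_exists:
  fixes m :: "complex \<Rightarrow> complex"
  assumes m: "\<And>u. cmod u = 1 \<Longrightarrow> m u * m (- u) = 1"
  shows "\<exists>F. (\<forall>x. F x \<noteq> 0) \<and> (\<forall>v e. tile_edge v e \<longrightarrow> F (v + e) = F v * m e)"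
proof -
  let ?V = "tiling_vertices T"
  obtain \<tau> :: real where \<tau>:
    "\<And>x y. \<lbrakk>x \<in> ?V; y \<in> ?V; Re x + \<tau> * Im x = Re y + \<tau> * Im y\<rbrakk> \<Longrightarrow> x = y"
    using generic_height by blast
  define h where "h z = Re z + \<tau> * Im z" for z
  have h_add: "h (a + b) = h a + h b" for a b by (simp add: h_def algebra_simps)
  \<comment> \<open>\<open>S\<close> is closed downwards, so the other corners of a tile with two
    downward edges at the new vertex already belong to it.\<close>
  define P where "P S \<longleftrightarrow> (S \<subseteq> ?V \<and> (\<forall>z\<in>S. \<forall>y\<in>?V. h y < h z \<longrightarrow> y \<in> S) \<longrightarrow>
    (\<exists>F. (\<forall>x. F x \<noteq> 0) \<and> (\<forall>v e. tile_edge v e \<longrightarrow> v \<in> S \<longrightarrow> v + e \<in> S \<longrightarrow> F (v + e) = F v * m e)))" for S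
  have "P ?V"
    using finite_vertices
  proof (induction rule: finite_ranking_induct[where f = h])
    case empty
    show ?case unfolding P_def by (intro impI exI[of _ "\<lambda>_. 1"]) auto
  next
    case (insert x S)
    show ?case
    proof (cases "x \<in> S")
      case True
      then show ?thesis using insert by (simp add: insert_absorb)
    next
      case xS: False
      show ?thesis
        unfolding P_def
      proof (intro impI, elim conjE)
        assume sub: "insert x S \<subseteq> ?V" and down: "\<forall>z\<in>insert x S. \<forall>y\<in>?V. h y < h z \<longrightarrow> y \<in> insert x S"
        have xV: "x \<in> ?V" and SV: "S \<subseteq> ?V" using sub by auto
        have below: "y \<in> S" if "y \<in> ?V" "h y < h x" for y
          using down that by force
        have "\<forall>z\<in>S. \<forall>y\<in>?V. h y < h z \<longrightarrow> y \<in> S"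
          using below insert.hyps(2) by (meson less_le_trans)
        then obtain F where F: "\<And>x. F x \<noteq> 0"
          "\<And>v e. tile_edge v e \<Longrightarrow> v \<in> S \<Longrightarrow> v + e \<in> S \<Longrightarrow> F (v + e) = F v * m e"
          using insert.IH SV unfolding P_def by blast
        have strict: "h y < h x" if "y \<in> S" for y
        proof -
          have "h y \<noteq> h x" using \<tau>[of y x] that SV xV xS by (auto simp: h_def)
          then show ?thesis using insert.hyps(2)[OF that] by simp
        qed
        \<comment> \<open>\<open>g e\<close> is the value at \<open>x\<close> forced by the
          neighbour \<open>x + e\<close>.\<close>
        define g where "g e = F (x + e) * m (- e)" for e
        have g_agree: "g e = g e'" if "tile_edge x e" "h e < 0" "tile_edge x e'" "h e' < 0" for e e'
        \<comment> \<open>Both routes from the opposite corner \<open>x + u + w\<close> to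
          \<open>x\<close> multiply its value by \<open>m (- u) * m (- w)\<close>.\<close>
        proof (rule down_edges_agree[of x \<tau> g e e', folded h_def])
          fix t u w assume t: "t \<in> T" "tile_corner t x u w" "h u < 0" "h w < 0"
          note r1 = tile_corner_rotate[OF t(2)]
          note r2 = tile_corner_rotate[OF r1]
          have "x + u \<in> S" "x + w \<in> S" "x + u + w \<in> S"
            using tile_corner_vertices[OF t(1,2)] t(3,4) below by (auto simp: h_add)
          then have "F (x + u + w + - u) = F (x + u + w) * m (- u)"
              "F (x + u + w + - w) = F (x + u + w) * m (- w)"
            using F(2)[OF tile_edgeI(1)[OF t(1) r2]] F(2)[OF tile_edgeI(2)[OF t(1) r2]] by simp_all
          then show "g u = g w" by (simp add: g_def)
        qed (use that in auto)
        \<comment> \<open>A vertex with no downward edge is unconstrained and gets the nonzero value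
          1.\<close>
        define val where "val = (if \<exists>e. tile_edge x e \<and> h e < 0 then g (SOME e. tile_edge x e \<and> h e < 0) else 1)"
        have val: "val = g e" if "tile_edge x e" "h e < 0" for e
        proof -
          have "tile_edge x (SOME e. tile_edge x e \<and> h e < 0) \<and> h (SOME e. tile_edge x e \<and> h e < 0) < 0"
            using that by (intro someI_ex[of "\<lambda>e. tile_edge x e \<and> h e < 0"]) blast
          moreover have "val = g (SOME e. tile_edge x e \<and> h e < 0)"
            unfolding val_def by (rule if_P) (use that in blast)
          ultimately show ?thesis using g_agree[OF _ _ that] by simp
        qed
        have val0: "val \<noteq> 0"
        proof (cases "\<exists>e. tile_edge x e \<and> h e < 0")
          case True
          then obtain e where e: "tile_edge x e" "h e < 0" by blast
          then have "m (- e) \<noteq> 0" using m[of e] tile_edge_vertices(3)[OF e(1)] by auto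
          then show ?thesis using val[OF e] F(1) by (simp add: g_def)
        next
          case False
          have "val = 1" unfolding val_def by (rule if_not_P[OF False])
          then show ?thesis by simp
        qed
        show "\<exists>F. (\<forall>x. F x \<noteq> 0) \<and> (\<forall>v e. tile_edge v e \<longrightarrow> v \<in> insert x S \<longrightarrow> v + e \<in> insert x S \<longrightarrow> F (v + e) = F v * m e)"
        proof (intro exI[of _ "F(x := val)"] conjI allI impI)
          fix y show "(F(x := val)) y \<noteq> 0" using F(1) val0 by simp
        next
          fix v e assume e: "tile_edge v e" "v \<in> insert x S" "v + e \<in> insert x S"
          have ne: "v + e \<noteq> v" and e1: "cmod e = 1" using tile_edge_vertices(3)[OF e(1)] by auto
          consider "v = x" "v + e \<in> S" "v + e \<noteq> x" | "v + e = x" "v \<in> S" "v \<noteq> x"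
            | "v \<in> S" "v + e \<in> S" "v \<noteq> x" "v + e \<noteq> x"
            using e(2,3) xS ne by (cases "v = x"; cases "v + e = x"; auto)
          then show "(F(x := val)) (v + e) = (F(x := val)) v * m e"
          proof cases
            case 1
            then have "h e < 0" using strict[of "v + e"] by (simp add: h_add)
            then have "val = F (x + e) * m (- e)" using val e 1 by (simp add: g_def)
            then show ?thesis using 1 m[OF e1] by (simp add: mult.assoc mult.commute)
          next
            case 2
            have ed: "tile_edge x (- e)" using tile_edge_sym[OF e(1)] 2 by simp
            have v: "v = x + - e" using 2 by auto
            have "h v = h x + h (- e)" unfolding v by (rule h_add)
            then have "h (- e) < 0" using strict[OF 2(2)] by linarith
            then have "val = g (- e)" by (rule val[OF ed])
            then have "val = F v * m e" using v by (simp only: g_def minus_minus)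
            then show ?thesis using 2 by simp
          next
            case 3
            then show ?thesis using F(2)[OF e(1)] by simp
          qed
        qed
      qed
    qed
  qed
  then obtain F where F: "\<forall>x. F x \<noteq> 0"
    "\<forall>v e. tile_edge v e \<longrightarrow> v \<in> ?V \<longrightarrow> v + e \<in> ?V \<longrightarrow> F (v + e) = F v * m e"
    unfolding P_def by blast
  then show ?thesis
    using tile_edge_vertices by (intro exI[of _ F]) blast
qed

text \<open>The bound on \<open>z\<close> keeps \<open>z + e\<close> and \<open>z - e\<close>
  nonzero for unit \<open>e\<close>. With \<open>m e = (z + e) / (z - e)\<close>, both sides of the
  tile identity are \<open>2 * z * (w - u) * (u + w) / ((z - u) * (z - w))\<close> times
  \<open>F v\<close>.\<close>

lemma discrete_exponential_exists:
  assumes z: "cmod z > 1"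
  shows "\<exists>F. disc_holomorphic F \<and> (\<forall>x. F x \<noteq> 0) \<and>
    (\<forall>v e. tile_edge v e \<longrightarrow> F (v + e) * (z - e) = F v * (z + e))"
proof -
  have nz: "z - e \<noteq> 0" "z + e \<noteq> 0" if "cmod e = 1" for e
  proof -
    show "z - e \<noteq> 0" using that z by auto
    show "z + e \<noteq> 0" using that z by (metis add.inverse_unique less_irrefl norm_minus_cancel)
  qed
  define m where "m e = (z + e) / (z - e)" for e
  have "m u * m (- u) = 1" if "cmod u = 1" for u
    using nz[OF that] by (simp add: m_def)
  then obtain F where F: "\<forall>x. F x \<noteq> 0" "\<And>v e. tile_edge v e \<Longrightarrow> F (v + e) = F v * m e"
    using multiplicative_potential_exists[of m] by blast
  have "disc_holomorphic F"
    unfolding disc_holomorphic_def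
  proof (intro ballI allI impI)
    fix t v u w assume t: "t \<in> T" "tile_corner t v u w"
    note n = nz[OF tile_cornerD(1)[OF t(2)]] nz[OF tile_cornerD(2)[OF t(2)]]
    have 1: "F (v + u) = F v * m u" "F (v + w) = F v * m w"
      using F(2) tile_edgeI[OF t] by blast+
    have 2: "F (v + u + w) = F v * m u * m w"
      using F(2)[OF tile_edgeI(1)[OF t(1) tile_corner_rotate[OF t(2)]]] 1 by simp
    have "(m w - m u) * (u + w) = (m u * m w - 1) * (w - u)"
      unfolding m_def using n by (simp add: divide_simps) (simp add: algebra_simps)
    then have "F v * ((m w - m u) * (u + w)) = F v * ((m u * m w - 1) * (w - u))" by simp
    then show "(F (v + w) - F (v + u)) * (u + w) = (F (v + u + w) - F v) * (w - u)"
      unfolding 1 2 by (simp add: algebra_simps)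
  qed
  moreover have "F (v + e) * (z - e) = F v * (z + e)" if "tile_edge v e" for v e
    using F(2)[OF that] nz[OF tile_edge_vertices(3)[OF that]] by (simp add: m_def)
  ultimately show ?thesis using F(1) by blast
qed

lemma disc_holomorphic_sum:
  assumes "\<And>i. i \<in> I \<Longrightarrow> disc_holomorphic (F i)"
  shows "disc_holomorphic (\<lambda>x. \<Sum>i\<in>I. c i * F i x)"
  unfolding disc_holomorphic_def
proof (intro ballI allI impI)
  fix t v u w assume t: "t \<in> T" "tile_corner t v u w"
  have "(F i (v + w) - F i (v + u)) * (u + w) = (F i (v + u + w) - F i v) * (w - u)" if "i \<in> I" for i
    using assms[OF that] t unfolding disc_holomorphic_def by blast
  then have "(\<Sum>i\<in>I. c i * ((F i (v + w) - F i (v + u)) * (u + w))) =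
      (\<Sum>i\<in>I. c i * ((F i (v + u + w) - F i v) * (w - u)))"
    by (intro sum.cong) auto
  then show "((\<Sum>i\<in>I. c i * F i (v + w)) - (\<Sum>i\<in>I. c i * F i (v + u))) * (u + w) =
       ((\<Sum>i\<in>I. c i * F i (v + u + w)) - (\<Sum>i\<in>I. c i * F i v)) * (w - u)"
    by (simp only: sum_subtractf[symmetric] sum_distrib_right right_diff_distrib left_diff_distrib mult.assoc)
qed

end

section \<open>The regular polygon\<close>

lemma wedge_mult_left: "wedge (z * x) (z * y) = (cmod z)\<^sup>2 * wedge x y"
  unfolding cmod_power2 by (simp add: wedge_def power2_eq_square algebra_simps)

text \<open>The orientation of two chords from one point of the circle becomes a product of sines of
  half angles, whose signs can be read off.\<close>

lemma wedge_cis_minus_1: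
  "wedge (cis x - 1) (cis y - 1) = 4 * sin (x / 2) * sin (y / 2) * sin ((y - x) / 2)"
proof -
  have 1: "cos x - 1 = - 2 * (sin (x / 2))\<^sup>2" "cos y - 1 = - 2 * (sin (y / 2))\<^sup>2"
    using cos_double_sin[of "x / 2"] cos_double_sin[of "y / 2"] by simp_all
  have 2: "sin x = 2 * sin (x / 2) * cos (x / 2)" "sin y = 2 * sin (y / 2) * cos (y / 2)"
    using sin_double[of "x / 2"] sin_double[of "y / 2"] by simp_all
  have 3: "sin ((y - x) / 2) = sin (y / 2) * cos (x / 2) - cos (y / 2) * sin (x / 2)"
    using sin_diff[of "y / 2" "x / 2"] by (simp add: diff_divide_distrib)
  have "wedge (cis x - 1) (cis y - 1) = (cos x - 1) * sin y - sin x * (cos y - 1)"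
    by (simp add: wedge_def)
  also have "\<dots> = 4 * sin (x / 2) * sin (y / 2) * sin ((y - x) / 2)"
    unfolding 1 2 3 by (simp add: power2_eq_square algebra_simps)
  finally show ?thesis .
qed

lemma cmod_cis_minus_1: "cmod (cis x - 1) = 2 * \<bar>sin (x / 2)\<bar>"
proof -
  have "(cmod (cis x - 1))\<^sup>2 = (cos x - 1)\<^sup>2 + (sin x)\<^sup>2"
    by (simp add: cmod_power2)
  also have "\<dots> = 2 - 2 * cos x"
    using sin_cos_squared_add[of x] by (simp add: power2_eq_square algebra_simps)
  also have "\<dots> = (2 * \<bar>sin (x / 2)\<bar>)\<^sup>2"
    using cos_double_sin[of "x / 2"] by (simp add: power_mult_distrib)
  finally show ?thesis by (rule power2_eq_imp_eq) auto
qed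

section \<open>Corners, sides and angles of the polygon\<close>

locale polygon_tiling =
  fixes N :: nat and c :: complex and a :: real and T :: "rhomb set"
  assumes N: "N \<ge> 2" and polygon_tiling: "rhombus_tiling T (reg_polygon N c a)"
begin

sublocale convex_tiling T "reg_polygon N c a"
  by unfold_locales (use polygon_tiling in \<open>simp_all add: reg_polygon_def\<close>)

abbreviation R :: "complex set" where "R \<equiv> reg_polygon N c a"

abbreviation pv :: "nat \<Rightarrow> complex" where "pv \<equiv> poly_vertex N c a"

definition q :: complex where "q = cis (- pi / real N)"

definition side :: "nat \<Rightarrow> complex" where "side k = pv (Suc k) - pv k"

lemma q_power: "q ^ k = cis (- pi * real k / real N)"
proof -
  have "real k * (- pi / real N) = - pi * real k / real N" by simp
  then show ?thesis by (simp only: q_def Complex.DeMoivre)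
qed

lemma q_power_N: "q ^ N = - 1"
proof -
  have "- pi * real N / real N = - pi" using N by simp
  then show ?thesis unfolding q_power by (simp add: cis.ctr complex_eq_iff)
qed

lemma q_power_2N: "q ^ (2 * N) = 1"
  by (simp add: mult.commute[of 2] power_mult q_power_N)

lemma q_nonzero [simp]: "q \<noteq> 0"
  by (simp add: q_def)

lemma cmod_q [simp]: "cmod q = 1"
  by (simp add: q_def)

lemma q_power_neq_1:
  assumes "1 \<le> m" "m \<le> N" shows "q ^ m \<noteq> 1"
proof (cases "m = N")
  case True
  then show ?thesis by (simp add: q_power_N)
next
  case False
  then have "pi * real m / real N < pi" using assms by (simp add: divide_less_eq)
  moreover have "pi * real m / real N > 0" using assms by simp
  ultimately have "sin (pi * real m / real N) > 0" by (rule sin_gt_zero[rotated])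
  then have "Im (q ^ m) \<noteq> 0" unfolding q_power by simp
  then show ?thesis by auto
qed

definition circumradius :: real where "circumradius = 1 / (2 * sin (pi / (2 * real N)))"

lemma sin_half_pos: "sin (pi / (2 * real N)) > 0"
  using N by (intro sin_gt_zero) (auto simp: divide_less_eq)

lemma circumradius_pos: "circumradius > 0"
  using sin_half_pos by (simp add: circumradius_def)

lemma pv_eq: "pv k = c + of_real circumradius * cis a * q ^ k"
proof -
  have "cis (a - pi * real k / real N) = cis a * q ^ k"
    unfolding q_power cis_mult by simp
  then show ?thesis by (simp add: poly_vertex_def circumradius_def)
qed

lemma pv_eq_iff: "pv j = pv k \<longleftrightarrow> q ^ j = q ^ k"
  using circumradius_pos by (simp add: pv_eq)

lemma side_eq: "side k = side 0 * q ^ k"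
  by (simp add: side_def pv_eq algebra_simps)

lemma cmod_side [simp]: "cmod (side k) = 1"
proof -
  have "side 0 = of_real circumradius * cis a * (q - 1)"
    by (simp add: side_def pv_eq algebra_simps)
  moreover have "cmod (q - 1) = 2 * sin (pi / (2 * real N))"
    using sin_half_pos unfolding q_def cmod_cis_minus_1 by (simp add: mult.commute)
  ultimately have "cmod (side 0) = 1"
    using sin_half_pos circumradius_pos by (simp add: norm_mult) (simp add: circumradius_def)
  then show ?thesis by (simp add: side_eq[of k] norm_mult norm_power)
qed

lemma side_nonzero [simp]: "side k \<noteq> 0"
  using cmod_side[of k] by force

lemma side_add_N: "side (k + N) = - side k"
  by (simp add: side_eq[of "k + N"] side_eq[of k] power_add q_power_N)

lemma pv_shift: "\<exists>n<2 * N. pv j = pv (k + n)"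
proof (intro exI conjI)
  \<comment> \<open>The term \<open>(2 * N - 1) * k\<close> represents \<open>- k\<close> modulo
    \<open>2 * N\<close>, which avoids a truncated subtraction \<open>j - k\<close>.\<close>
  let ?n = "(j + (2 * N - 1) * k) mod (2 * N)"
  show "?n < 2 * N" using N by simp
  have red: "q ^ (x mod (2 * N)) = q ^ x" for x
  proof -
    have "q ^ x = q ^ (2 * N * (x div (2 * N)) + x mod (2 * N))" by simp
    also have "\<dots> = q ^ (x mod (2 * N))"
      by (simp only: power_add power_mult[of q "2 * N"] q_power_2N power_one mult_1)
    finally show ?thesis by simp
  qed
  have "(2 * N - 1) * k + k = 2 * N * k"
    using N by (cases N) simp_all
  then have "k + (j + (2 * N - 1) * k) = j + 2 * N * k" by linarith
  then have "q ^ (k + ?n) = q ^ (j + 2 * N * k)"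
    by (metis red power_add)
  also have "\<dots> = q ^ j"
    by (simp only: power_add power_mult[of q "2 * N"] q_power_2N power_one mult_1_right)
  finally show "pv j = pv (k + ?n)" by (simp add: pv_eq_iff)
qed

lemma pv_in_R: "pv k \<in> R"
proof -
  obtain n where "n < 2 * N" "pv k = pv (0 + n)" using pv_shift by blast
  then show ?thesis unfolding reg_polygon_def by (intro hull_inc) auto
qed

text \<open>By periodicity every corner has a predecessor index, so statements about
  \<open>pv (Suc k)\<close> reach all corners.\<close>

lemma pv_Suc_cases: "\<exists>k. pv j = pv (Suc k)"
  using pv_shift[of j 1] by auto

lemma halfplane_vertex: "wedge (pv j - pv k) (side k) \<ge> 0"
proof -
  obtain n where n: "n < 2 * N" "pv j = pv (k + n)" using pv_shift by blast
  define z where "z = of_real circumradius * cis a * q ^ k"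
  have "pv (k + n) - pv k = z * (cis (- pi * real n / real N) - 1)"
    by (simp add: pv_eq z_def power_add q_power[of n] algebra_simps)
  moreover have "side k = z * (cis (- pi / real N) - 1)"
    unfolding q_def[symmetric] by (simp add: side_def pv_eq z_def algebra_simps)
  ultimately have "wedge (pv j - pv k) (side k) = (cmod z)\<^sup>2 *
      (4 * sin (- pi * real n / real N / 2) * sin (- pi / real N / 2) *
        sin ((- pi / real N - - pi * real n / real N) / 2))"
    unfolding n(2) by (simp only: wedge_mult_left wedge_cis_minus_1)
  also have "(- pi / real N - - pi * real n / real N) / 2 = pi * (real n - 1) / (2 * real N)"
    using N by (simp add: field_simps)
  also have "sin (- pi * real n / real N / 2) = - sin (pi * real n / (2 * real N))"
    by (simp add: mult.commute)
  also have "sin (- pi / real N / 2) = - sin (pi / (2 * real N))"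
    by (simp add: mult.commute)
  finally have eq: "wedge (pv j - pv k) (side k) = (cmod z)\<^sup>2 *
      (4 * (sin (pi * real n / (2 * real N)) * sin (pi / (2 * real N)) *
        sin (pi * (real n - 1) / (2 * real N))))"
    by simp
  show ?thesis
  \<comment> \<open>For \<open>n = 0\<close> the last angle is negative, but then the first sine
    vanishes.\<close>
  proof (cases "n = 0")
    case True
    then show ?thesis unfolding eq by simp
  next
    case False
    have "sin (pi * real n / (2 * real N)) \<ge> 0"
      using n N by (intro sin_ge_zero) (auto simp: divide_le_eq)
    moreover have "sin (pi * (real n - 1) / (2 * real N)) \<ge> 0"
      using n N False by (intro sin_ge_zero) (auto simp: divide_le_eq)
    ultimately show ?thesis unfolding eq using sin_half_pos by simp
  qed
qed

lemma halfplane: "y \<in> R \<Longrightarrow> wedge (y - pv k) (side k) \<ge> 0"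
proof -
  have "R \<subseteq> {y. wedge (y - pv k) (side k) \<ge> 0}"
    unfolding reg_polygon_def using halfplane_vertex by (intro hull_minimal convex_wedge_ge) auto
  then show "y \<in> R \<Longrightarrow> wedge (y - pv k) (side k) \<ge> 0" by blast
qed

text \<open>The corners run clockwise, so the interior angle at \<open>pv (Suc k)\<close> opens
  counterclockwise from the previous corner to the next one.\<close>

lemma wedge_sides: "wedge (- side k) (side (Suc k)) > 0"
proof -
  have "wedge (side k * 1) (side k * q) = Im q"
    unfolding wedge_mult_left by (simp add: wedge_def)
  then have "wedge (- side k) (side (Suc k)) = - Im q"
    by (simp add: wedge_minus_left side_eq[of k] side_eq[of "Suc k"] mult.assoc mult.commute[of q])
  also have "- Im q = sin (pi / real N)" by (simp add: q_def)
  also have "\<dots> > 0" using N by (intro sin_gt_zero) (auto simp: divide_less_eq)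
  finally show ?thesis .
qed

lemma region_in_cone:
  assumes "pv (Suc k) + x \<in> R" shows "x \<in> corner_cone (- side k) (side (Suc k))"
proof -
  have "pv (Suc k) + x - pv k = x + side k" by (simp add: side_def)
  then have "wedge (x + side k) (side k) \<ge> 0" using halfplane[OF assms, of k] by metis
  then show ?thesis
    using halfplane[OF assms, of "Suc k"]
    by (simp add: corner_cone_def wedge_simps wedge_commute[of "side k" x])
qed

lemma pv_neighbours: "pv (Suc k) + - side k = pv k" "pv (Suc k) + side (Suc k) = pv (Suc (Suc k))"
  by (simp_all add: side_def)

lemma polygon_direction:
  assumes "x \<in> corner_cone (- side k) (side (Suc k))" "x \<noteq> 0"
  shows "\<exists>\<delta>>0. pv (Suc k) + \<delta> *\<^sub>R x \<in> R"
proof -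
  define b d where "b = - side k" and "d = side (Suc k)"
  define \<alpha> \<beta> where "\<alpha> = wedge x d / wedge b d" and "\<beta> = wedge b x / wedge b d"
  have D: "wedge b d > 0" using wedge_sides by (simp add: b_def d_def)
  have x: "x = \<alpha> *\<^sub>R b + \<beta> *\<^sub>R d"
    unfolding \<alpha>_def \<beta>_def using D by (intro wedge_coordinates) auto
  have ab: "\<alpha> \<ge> 0" "\<beta> \<ge> 0"
    using assms(1) D by (auto simp: \<alpha>_def \<beta>_def corner_cone_def b_def d_def)
  moreover have "\<alpha> \<noteq> 0 \<or> \<beta> \<noteq> 0" using x assms(2) by auto
  ultimately have s: "\<alpha> + \<beta> > 0" by linarith
  \<comment> \<open>This factor puts the point on the segment between the two neighbouring
    corners.\<close>
  define \<delta> where "\<delta> = 1 / (\<alpha> + \<beta>)"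
  have \<delta>: "\<delta> > 0" "\<delta> * \<alpha> + \<delta> * \<beta> = 1" using s by (simp_all add: \<delta>_def flip: add_divide_distrib)
  have "(\<delta> * \<alpha>) *\<^sub>R (pv (Suc k) + b) + (\<delta> * \<beta>) *\<^sub>R (pv (Suc k) + d) \<in> R"
    unfolding b_def d_def pv_neighbours using ab \<delta> pv_in_R
    by (intro convexD[OF convex_region]) auto
  also have "(\<delta> * \<alpha>) *\<^sub>R (pv (Suc k) + b) + (\<delta> * \<beta>) *\<^sub>R (pv (Suc k) + d)
      = (\<delta> * \<alpha> + \<delta> * \<beta>) *\<^sub>R pv (Suc k) + \<delta> *\<^sub>R x"
    unfolding x by (simp add: scaleR_add_right scaleR_add_left)
  finally show ?thesis using \<delta> by (intro exI[of _ \<delta>]) simp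
qed

text \<open>This supplies the hypothesis of the matching lemmas for edges strictly inside the angle
  of the corner.\<close>

lemma polygon_direction_perturbed:
  assumes "wedge (- side k) d > 0" "wedge d (side (Suc k)) > 0"
  shows "\<forall>\<^sub>F \<eta> in at_right 0. \<exists>\<delta>>0. pv (Suc k) + \<delta> *\<^sub>R (d + \<eta> *\<^sub>R y) \<in> R"
proof -
  have "((\<lambda>\<eta>. wedge (- side k) (d + \<eta> *\<^sub>R y)) \<longlongrightarrow> wedge (- side k) d) (at_right 0)"
    "((\<lambda>\<eta>. wedge (d + \<eta> *\<^sub>R y) (side (Suc k))) \<longlongrightarrow> wedge d (side (Suc k))) (at_right 0)"
    unfolding wedge_def by (auto intro!: tendsto_eq_intros)
  then have "\<forall>\<^sub>F \<eta> in at_right 0. wedge (- side k) (d + \<eta> *\<^sub>R y) > 0"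
    "\<forall>\<^sub>F \<eta> in at_right 0. wedge (d + \<eta> *\<^sub>R y) (side (Suc k)) > 0"
    using assms by (auto dest: order_tendstoD)
  then show ?thesis
  proof eventually_elim
    case (elim \<eta>)
    then show ?case
      by (intro polygon_direction) (auto simp: corner_cone_def wedge_0_right wedge_0_left)
  qed
qed

lemma pv_extreme: "pv k extreme_point_of R"
proof -
  obtain j where j: "pv k = pv (Suc j)" using pv_Suc_cases by blast
  show ?thesis
    unfolding extreme_point_of_def
  proof (intro conjI ballI)
    fix x y assume xy: "x \<in> R" "y \<in> R"
    define b d where "b = - side j" and "d = side (Suc j)"
    have D: "wedge b d > 0" using wedge_sides by (simp add: b_def d_def)
    have cx: "x - pv k \<in> corner_cone b d" "y - pv k \<in> corner_cone b d"
      unfolding b_def d_def by (rule region_in_cone, use xy j in simp)+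
    show "pv k \<notin> open_segment x y"
    proof
      assume "pv k \<in> open_segment x y"
      then obtain s where s: "0 < s" "s < 1" "pv k = (1 - s) *\<^sub>R x + s *\<^sub>R y" and "x \<noteq> y"
        by (auto simp: in_segment)
      then have z: "(1 - s) *\<^sub>R (x - pv k) + s *\<^sub>R (y - pv k) = 0"
        by (simp add: algebra_simps)
      have "(1 - s) * wedge b (x - pv k) + s * wedge b (y - pv k) = 0"
        "(1 - s) * wedge (x - pv k) d + s * wedge (y - pv k) d = 0"
        using arg_cong[OF z, of "wedge b"] arg_cong[OF z, of "\<lambda>z. wedge z d"]
        by (simp_all only: wedge_simps)
      moreover have "(1 - s) * wedge b (x - pv k) \<ge> 0" "s * wedge b (y - pv k) \<ge> 0"
        "(1 - s) * wedge (x - pv k) d \<ge> 0" "s * wedge (y - pv k) d \<ge> 0"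
        using cx s by (simp_all add: corner_cone_def)
      ultimately have "(1 - s) * wedge b (x - pv k) = 0" "s * wedge b (y - pv k) = 0"
        "(1 - s) * wedge (x - pv k) d = 0" "s * wedge (y - pv k) d = 0"
        by linarith+
      then have "wedge b (x - pv k) = 0" "wedge b (y - pv k) = 0"
        "wedge (x - pv k) d = 0" "wedge (y - pv k) d = 0"
        using s by simp_all
      then have "x - pv k = 0" "y - pv k = 0"
        using D wedge_coordinates[of b d "x - pv k"] wedge_coordinates[of b d "y - pv k"] by simp_all
      then show False using \<open>x \<noteq> y\<close> by simp
    qed
  qed (rule pv_in_R)
qed

section \<open>Tiles along the boundary of the polygon\<close>

lemma pv_tiling_vertex: "pv k \<in> tiling_vertices T"
proof -
  obtain t where t: "t \<in> T" "pv k \<in> tile_region t" using pv_in_R region_eq by blast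
  have "tile_region t \<subseteq> R" using t region_eq by blast
  then have "pv k extreme_point_of (convex hull corners t)"
    using pv_extreme[of k] t(2) unfolding extreme_point_of_def tile_region_def by blast
  then show ?thesis
    using t(1) extreme_point_of_convex_hull unfolding tiling_vertices_def by blast
qed

lemma edge_in_polygon_cone:
  assumes "t \<in> tiles_at (pv (Suc k))"
  shows "first_edge t (pv (Suc k)) \<in> corner_cone (- side k) (side (Suc k))"
    "second_edge t (pv (Suc k)) \<in> corner_cone (- side k) (side (Suc k))"
proof -
  have t: "t \<in> T" using assms by (simp add: tiles_at_def)
  have "pv (Suc k) + first_edge t (pv (Suc k)) \<in> R" "pv (Suc k) + second_edge t (pv (Suc k)) \<in> R"
    using tile_corner_corners[OF tiles_at_edges[OF assms]] corner_in_region[OF t] by auto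
  then show "first_edge t (pv (Suc k)) \<in> corner_cone (- side k) (side (Suc k))"
    "second_edge t (pv (Suc k)) \<in> corner_cone (- side k) (side (Suc k))"
    by (auto intro: region_in_cone)
qed

text \<open>For the tile covering the direction \<open>- side k\<close>, that direction is in the
  tile's cone and the tile's first edge is in the polygon's cone. This bounds their wedge by 0 from
  both sides.\<close>

lemma boundary_first_edge: "\<exists>t\<in>tiles_at (pv (Suc k)). first_edge t (pv (Suc k)) = - side k"
proof -
  let ?v = "pv (Suc k)" and ?b = "- side k" and ?d = "side (Suc k)"
  have D: "wedge ?b ?d > 0" by (rule wedge_sides)
  have "?b \<in> corner_cone ?b ?d" using D by (rule edges_in_cone)
  then obtain \<delta> where "\<delta> > 0" "?v + \<delta> *\<^sub>R ?b \<in> R" using polygon_direction by force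
  then obtain t where t: "t \<in> tiles_at ?v" "?b \<in> corner_cone (first_edge t ?v) (second_edge t ?v)"
    using cone_cover[OF pv_tiling_vertex] by blast
  note tc = tile_cornerD[OF tiles_at_edges[OF t(1)]]
  note e = edge_in_polygon_cone(1)[OF t(1)]
  have "wedge ?b (first_edge t ?v) = 0"
    using t(2) e wedge_commute[of ?b "first_edge t ?v"] unfolding corner_cone_def by simp
  then have "first_edge t ?v = ?b"
    by (intro unit_in_cone_parallel(1)[OF _ _ _ D e] tc) auto
  then show ?thesis using t by blast
qed

lemma boundary_second_edge: "\<exists>t\<in>tiles_at (pv (Suc k)). second_edge t (pv (Suc k)) = side (Suc k)"
proof -
  let ?v = "pv (Suc k)" and ?b = "- side k" and ?d = "side (Suc k)"
  have D: "wedge ?b ?d > 0" by (rule wedge_sides)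
  have "?d \<in> corner_cone ?b ?d" using D by (rule edges_in_cone)
  then obtain \<delta> where "\<delta> > 0" "?v + \<delta> *\<^sub>R ?d \<in> R" using polygon_direction by force
  then obtain t where t: "t \<in> tiles_at ?v" "?d \<in> corner_cone (first_edge t ?v) (second_edge t ?v)"
    using cone_cover[OF pv_tiling_vertex] by blast
  note tc = tile_cornerD[OF tiles_at_edges[OF t(1)]]
  note e = edge_in_polygon_cone(2)[OF t(1)]
  have "wedge (second_edge t ?v) ?d = 0"
    using t(2) e wedge_commute[of ?d "second_edge t ?v"] unfolding corner_cone_def by simp
  then have "second_edge t ?v = ?d"
    by (intro unit_in_cone_parallel(2)[OF _ _ _ D e] tc) auto
  then show ?thesis using t by blast
qed

lemma tile_edge_side: "tile_edge (pv k) (side k)"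
proof -
  obtain t where t: "t \<in> tiles_at (pv (Suc k))" "first_edge t (pv (Suc k)) = - side k"
    using boundary_first_edge by blast
  then have "tile_edge (pv (Suc k)) (- side k)"
    using tile_edgeI(1)[OF _ tiles_at_edges[OF t(1)]] by (simp add: tiles_at_def)
  from tile_edge_sym[OF this] show ?thesis using pv_neighbours(1)[of k] by simp
qed

text \<open>Edges strictly inside the angle occur both as first and as second edges and cancel;
  \<open>- side k\<close> is only a first edge and \<open>side (Suc k)\<close> only a second
  one.\<close>

lemma polygon_corner_sum:
  fixes F :: "complex \<Rightarrow> complex"
  defines "v k \<equiv> pv (Suc k)"
  shows "(\<Sum>t\<in>tiles_at (v k). F (v k + second_edge t (v k)) - F (v k + first_edge t (v k))) =
    F (pv (Suc (Suc k))) - F (pv k)"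
proof -
  let ?v = "pv (Suc k)" and ?b = "- side k" and ?d = "side (Suc k)"
  have D: "wedge ?b ?d > 0" by (rule wedge_sides)
  define U W where "U = (\<lambda>t. first_edge t ?v) ` tiles_at ?v" and "W = (\<lambda>t. second_edge t ?v) ` tiles_at ?v"
  have fin: "finite U" "finite W" using finite_tiles_at by (simp_all add: U_def W_def)
  have bU: "?b \<in> U" and dW: "?d \<in> W"
    using boundary_first_edge[of k] boundary_second_edge[of k] by (force simp: U_def W_def)+
  have dU: "?d \<notin> U"
  proof
    assume "?d \<in> U"
    then obtain t where t: "t \<in> tiles_at ?v" "first_edge t ?v = ?d" by (auto simp: U_def)
    from tile_cornerD(3)[OF tiles_at_edges[OF t(1)]] edge_in_polygon_cone(2)[OF t(1)]
    show False unfolding t(2) corner_cone_def using wedge_commute[of ?d "second_edge t ?v"] by simp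
  qed
  have bW: "?b \<notin> W"
  proof
    assume "?b \<in> W"
    then obtain t where t: "t \<in> tiles_at ?v" "second_edge t ?v = ?b" by (auto simp: W_def)
    from tile_cornerD(3)[OF tiles_at_edges[OF t(1)]] edge_in_polygon_cone(1)[OF t(1)]
    show False unfolding t(2) corner_cone_def using wedge_commute[of ?b "first_edge t ?v"] by simp
  qed
  have strict: "wedge ?b x > 0" "wedge x ?d > 0"
    if "x \<in> corner_cone ?b ?d" "cmod x = 1" "x \<noteq> ?b" "x \<noteq> ?d" for x
  proof -
    have "wedge ?b x \<noteq> 0" "wedge x ?d \<noteq> 0"
      using unit_in_cone_parallel[OF _ _ that(2) D that(1)] that(3,4) by auto
    then show "wedge ?b x > 0" "wedge x ?d > 0" using that(1) by (auto simp: corner_cone_def)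
  qed
  have "U - {?b} \<subseteq> W - {?d}"
  proof
    fix x assume x: "x \<in> U - {?b}"
    then obtain t where t: "t \<in> tiles_at ?v" "x = first_edge t ?v" by (auto simp: U_def)
    have xd: "x \<noteq> ?d" using x dU by auto
    have "x \<in> corner_cone ?b ?d" "cmod x = 1"
      using edge_in_polygon_cone[OF t(1)] tile_cornerD[OF tiles_at_edges[OF t(1)]] t(2) by auto
    from strict[OF this] x xd have "wedge ?b x > 0" "wedge x ?d > 0" by auto
    from match_first_edge[OF t polygon_direction_perturbed[OF this]] xd
    show "x \<in> W - {?d}" unfolding W_def by (auto simp: image_iff)
  qed
  moreover have "W - {?d} \<subseteq> U - {?b}"
  proof
    fix x assume x: "x \<in> W - {?d}"
    then obtain t where t: "t \<in> tiles_at ?v" "x = second_edge t ?v" by (auto simp: W_def)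
    have xb: "x \<noteq> ?b" using x bW by auto
    have "x \<in> corner_cone ?b ?d" "cmod x = 1"
      using edge_in_polygon_cone[OF t(1)] tile_cornerD[OF tiles_at_edges[OF t(1)]] t(2) by auto
    from strict[OF this] x xb have "wedge ?b x > 0" "wedge x ?d > 0" by auto
    from match_second_edge[OF t polygon_direction_perturbed[OF this]] xb
    show "x \<in> U - {?b}" unfolding U_def by (auto simp: image_iff)
  qed
  ultimately have "U - {?b} = W - {?d}" by blast
  then have "(\<Sum>x\<in>W. F (?v + x)) - (\<Sum>x\<in>U. F (?v + x)) = F (?v + ?d) - F (?v + ?b)"
    by (simp add: sum.remove[OF fin(1) bU] sum.remove[OF fin(2) dW])
  then show ?thesis
    unfolding v_def tile_sum_telescope U_def W_def pv_neighbours .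
qed

lemma boundary_coloring:
  assumes "proper_coloring T col" shows "col (pv (Suc k)) \<longleftrightarrow> \<not> col (pv k)"
proof -
  let ?v = "pv (Suc k)"
  obtain t where t: "t \<in> tiles_at ?v" "first_edge t ?v = - side k"
    using boundary_first_edge by blast
  have tc: "tile_corner t ?v (- side k) (second_edge t ?v)" and tT: "t \<in> T"
    using tiles_at_edges[OF t(1)] t by (simp_all add: tiles_at_def)
  \<comment> \<open>The complementary coloring handles the case that \<open>pv (Suc k)\<close> is
    white.\<close>
  have col': "proper_coloring T (\<lambda>x. \<not> col x)"
    using assms unfolding proper_coloring_def by (auto split: prod.splits)
  show ?thesis
    using black_white_diag(4)[OF assms tT tc] black_white_diag(4)[OF col' tT tc]
    unfolding pv_neighbours by blast
qed

lemma boundary_coloring_parity: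
  assumes "proper_coloring T col" shows "col (pv k) \<longleftrightarrow> (col (pv 0) \<longleftrightarrow> even k)"
  by (induction k) (auto simp: boundary_coloring[OF assms])

lemma interior_nonempty: "interior R \<noteq> {}"
proof -
  obtain t where t: "t \<in> tiles_at (pv (Suc 0))" using boundary_first_edge by blast
  define v u w where "v = pv (Suc 0)" and "u = first_edge t v" and "w = second_edge t v"
  have tc: "tile_corner t v u w" and "t \<in> T"
    using tiles_at_edges t by (auto simp: v_def u_def w_def tiles_at_def)
  have "v + (1/4) *\<^sub>R (u + w) \<in> interior (tile_region t)"
    using tile_cornerD[OF tc] by (intro tile_corner_interior[OF tc]) (auto simp: wedge_simps)
  moreover have "interior (tile_region t) \<subseteq> interior R"
    using \<open>t \<in> T\<close> region_eq by (intro interior_mono) auto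
  ultimately show ?thesis by blast
qed

text \<open>A tiling vertex inside a tile is one of its corners, and of these only the two ends lie
  on the line of the edge.\<close>

lemma on_side_vertex:
  assumes x: "x \<in> tiling_vertices T" and e: "tile_edge v e" and v: "x = v + \<alpha> *\<^sub>R e"
    and \<alpha>: "0 \<le> \<alpha>" "\<alpha> \<le> 1"
  shows "x = v \<or> x = v + e"
proof -
  obtain t where t: "t \<in> tiles_at v" "e = first_edge t v \<or> e = second_edge t v"
    using tile_edge_at[OF e] .
  define u w where "u = first_edge t v" and "w = second_edge t v"
  have tc: "tile_corner t v u w" and tT: "t \<in> T"
    using tiles_at_edges t by (auto simp: u_def w_def tiles_at_def)
  note co = tile_corner_corners[OF tc] and D = tile_cornerD(3)[OF tc]
  have "v \<in> tile_region t" "v + e \<in> tile_region t"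
    using corners_subset_region[of t] co t(2) by (auto simp: u_def w_def)
  then have "(1 - \<alpha>) *\<^sub>R v + \<alpha> *\<^sub>R (v + e) \<in> tile_region t"
    unfolding tile_region_def using \<alpha> by (intro convexD convex_convex_hull) auto
  then have "x \<in> tile_region t" by (simp add: v algebra_simps)
  then have "x \<in> corners t" using x tT corner_in_tile unfolding tiling_vertices_def by blast
  then have "\<alpha> *\<^sub>R e \<in> {0, u, w, u + w}" using co v by (auto simp: add.assoc)
  moreover have "wedge e (\<alpha> *\<^sub>R e) = 0" by (simp add: wedge_simps)
  moreover have "wedge u (u + w) > 0" "wedge (u + w) w > 0" "wedge u w > 0"
    using D by (simp_all add: wedge_simps)
  ultimately have "\<alpha> *\<^sub>R e = 0 \<or> \<alpha> *\<^sub>R e = e"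
    using t(2)[folded u_def w_def] wedge_commute[of w u] wedge_commute[of w "u + w"] by force
  then show ?thesis using v by auto
qed

text \<open>Sides of the polygon are whole tile edges, so they have no vertices strictly inside. A
  supporting line at \<open>x\<close> also passes through a corner, and in the cone coordinates at
  that corner one coordinate of \<open>x\<close> vanishes, which puts \<open>x\<close> on the line
  of a side.\<close>

lemma frontier_vertex:
  assumes x: "x \<in> tiling_vertices T" "x \<in> frontier R"
  shows "\<exists>k. x = pv k"
proof -
  have xR: "x \<in> R" using x(1) corner_in_region by (auto simp: tiling_vertices_def)
  have "x \<notin> rel_interior R"
    using x(2) rel_interior_nonempty_interior[OF interior_nonempty] by (simp add: frontier_def)
  then obtain n where n: "n \<noteq> 0" "\<And>y. y \<in> R \<Longrightarrow> n \<bullet> x \<le> n \<bullet> y"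
    using supporting_hyperplane_rel_boundary[OF convex_region xR] by metis
  have "\<exists>j. n \<bullet> pv j \<le> n \<bullet> x"
  proof (rule ccontr)
    assume "\<nexists>j. n \<bullet> pv j \<le> n \<bullet> x"
    then have "R \<subseteq> {y. n \<bullet> y > n \<bullet> x}"
      unfolding reg_polygon_def by (intro hull_minimal convex_halfspace_gt) (auto simp: not_le)
    then show False using xR by blast
  qed
  then obtain j k where j: "n \<bullet> pv j \<le> n \<bullet> x" "pv j = pv (Suc k)" using pv_Suc_cases by metis
  let ?v = "pv (Suc k)"
  define b d where "b = - side k" and "d = side (Suc k)"
  define \<alpha> \<beta> where "\<alpha> = wedge (x - ?v) d / wedge b d" and "\<beta> = wedge b (x - ?v) / wedge b d"
  have nv: "n \<bullet> ?v = n \<bullet> x" using j n(2)[OF pv_in_R, of "Suc k"] by simp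
  have D: "wedge b d > 0" using wedge_sides by (simp add: b_def d_def)
  have xe: "x - ?v = \<alpha> *\<^sub>R b + \<beta> *\<^sub>R d"
    unfolding \<alpha>_def \<beta>_def using D by (intro wedge_coordinates) auto
  have "x - ?v \<in> corner_cone b d"
    unfolding b_def d_def by (rule region_in_cone) (use xR in simp)
  then have ab: "\<alpha> \<ge> 0" "\<beta> \<ge> 0"
    using D by (auto simp: \<alpha>_def \<beta>_def corner_cone_def)
  have "n \<bullet> (?v + b) \<ge> n \<bullet> x" "n \<bullet> (?v + d) \<ge> n \<bullet> x"
    unfolding b_def d_def pv_neighbours using n(2) pv_in_R by blast+
  then have nb: "n \<bullet> b \<ge> 0" "n \<bullet> d \<ge> 0"
    using nv by (simp_all only: inner_add_right)
  have "\<alpha> * (n \<bullet> b) + \<beta> * (n \<bullet> d) = n \<bullet> (x - ?v)" unfolding xe by (simp add: inner_add_right)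
  also have "\<dots> = 0" using nv by (simp add: inner_diff_right)
  finally have z: "\<alpha> * (n \<bullet> b) = 0" "\<beta> * (n \<bullet> d) = 0"
    using ab nb by (simp_all add: add_nonneg_eq_0_iff)
  have "n \<bullet> b \<noteq> 0 \<or> n \<bullet> d \<noteq> 0"
  proof (rule ccontr)
    assume "\<not> ?thesis"
    then have "n \<bullet> ((wedge n d / wedge b d) *\<^sub>R b + (wedge b n / wedge b d) *\<^sub>R d) = 0"
      by (simp add: inner_add_right)
    then have "n \<bullet> n = 0" using wedge_coordinates[of b d n] D by simp
    then show False using n(1) by simp
  qed
  then consider "\<beta> = 0" | "\<alpha> = 0" using z by auto
  then obtain e \<gamma> where e: "tile_edge ?v e" "x = ?v + \<gamma> *\<^sub>R e" "\<gamma> \<ge> 0" "\<exists>i. ?v + e = pv i"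
  proof cases
    case 1
    have "tile_edge ?v b" using tile_edge_sym[OF tile_edge_side[of k]] by (simp add: b_def side_def)
    moreover have "x = ?v + \<alpha> *\<^sub>R b" using xe 1 by (simp add: algebra_simps)
    moreover have "?v + b = pv k" by (simp add: b_def side_def)
    ultimately show thesis using that ab by blast
  next
    case 2
    have "tile_edge ?v d" using tile_edge_side by (simp add: d_def)
    moreover have "x = ?v + \<beta> *\<^sub>R d" using xe 2 by (simp add: algebra_simps)
    moreover have "?v + d = pv (Suc (Suc k))" by (simp add: d_def side_def)
    ultimately show thesis using that ab by blast
  qed
  obtain i where i: "?v + e = pv i" using e(4) by blast
  \<comment> \<open>Beyond the far end, \<open>x\<close> would make the corner \<open>pv i\<close>
    lie strictly between two points of the region.\<close>
  have "\<gamma> \<le> 1"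
  proof (rule ccontr)
    assume g: "\<not> \<gamma> \<le> 1"
    have "pv i = (1 - 1 / \<gamma>) *\<^sub>R ?v + (1 / \<gamma>) *\<^sub>R x"
      unfolding i[symmetric] e(2) using g by (simp add: algebra_simps)
    moreover have "?v \<noteq> x" using e(2) g tile_edge_vertices(3)[OF e(1)] by auto
    ultimately have "pv i \<in> open_segment ?v x"
      using g by (auto simp: in_segment intro!: exI[of _ "1 / \<gamma>"])
    then show False
      using pv_extreme[of i] pv_in_R[of "Suc k"] xR unfolding extreme_point_of_def by blast
  qed
  then show ?thesis
    using on_side_vertex[OF x(1) e(1,2,3)] i by metis
qed

end

section \<open>The response matrix\<close>

text \<open>Coefficients are extracted from polynomials of degree at most \<open>N\<close> by averaging over scaled
  roots of unity.\<close>

lemma moments_on_scaled_roots_of_unity: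
  fixes b :: "nat \<Rightarrow> complex" and N :: nat
  defines "\<zeta> m \<equiv> 2 * cis (2 * pi * real m / real (Suc N))"
  shows "\<exists>w. \<forall>i\<le>N. (\<Sum>m\<le>N. w m * \<zeta> m ^ i) = b i"
proof -
  let ?\<omega> = "cis (2 * pi / real (Suc N))"
  have \<zeta>: "\<zeta> m = 2 * ?\<omega> ^ m" for m
  proof -
    have "real m * (2 * pi / real (Suc N)) = 2 * pi * real m / real (Suc N)" by simp
    then show ?thesis by (simp only: \<zeta>_def Complex.DeMoivre)
  qed
  have \<omega>1: "?\<omega> ^ Suc N = 1"
  proof -
    have "real (Suc N) * (2 * pi / real (Suc N)) = 2 * pi" by simp
    then show ?thesis by (simp only: Complex.DeMoivre) simp
  qed
  have inj: "inj_on (\<lambda>k. ?\<omega> ^ k) {..N}"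
  proof -
    have "?\<omega> ^ k = cis (2 * pi * real k / real (Suc N))" for k
    proof -
      have "real k * (2 * pi / real (Suc N)) = 2 * pi * real k / real (Suc N)" by simp
      then show ?thesis by (simp only: Complex.DeMoivre)
    qed
    then show ?thesis
      using Complex.bij_betw_roots_unity[of "Suc N"] by (simp add: bij_betw_def lessThan_Suc_atMost)
  qed
  have orth: "(\<Sum>m\<le>N. \<zeta> m ^ j / \<zeta> m ^ i) = (if i = j then of_nat (Suc N) else 0)"
    if "i \<le> N" "j \<le> N" for i j
  proof (cases "i = j")
    case True
    then show ?thesis by (simp add: \<zeta>)
  next
    case False
    define \<rho> where "\<rho> = ?\<omega> ^ j / ?\<omega> ^ i"
    have "\<rho> \<noteq> 1" using inj_onD[OF inj, of j i] False that by (auto simp: \<rho>_def)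
    have "\<rho> ^ Suc N = 1"
      by (simp only: \<rho>_def power_divide power_mult[symmetric] mult.commute[of _ "Suc N"])
        (simp only: power_mult \<omega>1 power_one div_by_1)
    have "(\<Sum>m\<le>N. \<zeta> m ^ j / \<zeta> m ^ i) = (\<Sum>m\<le>N. 2 ^ j / 2 ^ i * \<rho> ^ m)"
      by (simp add: \<zeta> \<rho>_def power_mult_distrib power_divide power_mult[symmetric] mult.commute)
    also have "\<dots> = 2 ^ j / 2 ^ i * (\<Sum>m<Suc N. \<rho> ^ m)"
      by (simp only: sum_distrib_left lessThan_Suc_atMost)
    also have "(\<Sum>m<Suc N. \<rho> ^ m) = 0"
      using geometric_sum[OF \<open>\<rho> \<noteq> 1\<close>, of "Suc N"] \<open>\<rho> ^ Suc N = 1\<close> by simp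
    finally show ?thesis using False by simp
  qed
  \<comment> \<open>Inverse discrete Fourier transform; dividing by \<open>\<zeta> m ^ i\<close>
    also removes the radius 2.\<close>
  define w where "w m = (\<Sum>i\<le>N. b i / of_nat (Suc N) / \<zeta> m ^ i)" for m
  have "(\<Sum>m\<le>N. w m * \<zeta> m ^ j) = b j" if "j \<le> N" for j
  proof -
    have "(\<Sum>m\<le>N. w m * \<zeta> m ^ j) = (\<Sum>m\<le>N. \<Sum>i\<le>N. b i / of_nat (Suc N) * (\<zeta> m ^ j / \<zeta> m ^ i))"
      by (simp add: w_def sum_distrib_right)
    also have "\<dots> = (\<Sum>i\<le>N. b i / of_nat (Suc N) * (\<Sum>m\<le>N. \<zeta> m ^ j / \<zeta> m ^ i))"
      by (subst sum.swap) (simp only: sum_distrib_left)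
    also have "\<dots> = (\<Sum>i\<le>N. if i = j then b j else 0)"
      using that by (intro sum.cong refl) (simp add: orth del: of_nat_Suc)
    also have "\<dots> = b j" using that by simp
    finally show ?thesis .
  qed
  then show ?thesis by blast
qed

text \<open>The correction vanishes for \<open>x ^ N = 1\<close>. For \<open>x ^ N = - 1\<close> it
  turns the sum into \<open>- (x + 1) / (x - 1)\<close>, which is purely imaginary on the unit
  circle.\<close>

lemma sum_geometric_half_ends:
  fixes x :: complex
  assumes "N > 0"
  shows "(\<Sum>j\<le>N. (if j = 0 \<or> j = N then 1 / 2 else 1) * x ^ j) = (\<Sum>j<N. x ^ j) + (x ^ N - 1) / 2"
proof -
  have "(\<Sum>j\<le>N. (if j = 0 \<or> j = N then 1 / 2 else 1) * x ^ j) =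
      (\<Sum>j\<le>N. x ^ j - (if j = 0 then 1 / 2 else 0) - (if j = N then x ^ N / 2 else 0))"
    using assms by (intro sum.cong) auto
  also have "\<dots> = (\<Sum>j\<le>N. x ^ j) - 1 / 2 - x ^ N / 2"
    by (simp add: sum_subtractf)
  also have "(\<Sum>j\<le>N. x ^ j) = (\<Sum>j<N. x ^ j) + x ^ N"
    by (simp flip: lessThan_Suc_atMost)
  also have "(\<Sum>j<N. x ^ j) + x ^ N - 1 / 2 - x ^ N / 2 = (\<Sum>j<N. x ^ j) + (x ^ N - 1) / 2"
    by (simp add: field_simps)
  finally show ?thesis .
qed

lemma cis_half_angle_quotient:
  assumes "cis (- 2 * \<theta>) \<noteq> 1"
  shows "sin \<theta> \<noteq> 0"
    "(cis (- 2 * \<theta>) + 1) / (cis (- 2 * \<theta>) - 1) = \<i> * of_real (cos \<theta> / sin \<theta>)"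
proof -
  show s: "sin \<theta> \<noteq> 0"
  proof
    assume "sin \<theta> = 0"
    then have "cis (- 2 * \<theta>) = 1"
      by (simp add: complex_eq_iff cos_double_sin sin_double)
    then show False using assms by simp
  qed
  have p: "cis (- 2 * \<theta>) + 1 = cis (- \<theta>) * of_real (2 * cos \<theta>)"
    by (simp add: complex_eq_iff cos_double_cos sin_double power2_eq_square)
  have m: "cis (- 2 * \<theta>) - 1 = cis (- \<theta>) * (- \<i> * of_real (2 * sin \<theta>))"
    by (simp add: complex_eq_iff cos_double_sin sin_double power2_eq_square)
  show "(cis (- 2 * \<theta>) + 1) / (cis (- 2 * \<theta>) - 1) = \<i> * of_real (cos \<theta> / sin \<theta>)"
    unfolding p m using s by (simp add: field_simps)
qed

section \<open>Boundary values of discrete exponentials and the Dirichlet datum\<close>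

context polygon_tiling
begin

text \<open>The discrete exponential with parameter \<open>z\<close>, scaled by the product of its denominators, takes
  at \<open>pv k\<close> the value at \<open>z\<close> of this polynomial.\<close>

definition boundary_poly :: "nat \<Rightarrow> complex poly" where
  "boundary_poly k = (\<Prod>j<N. [:- side (k + j), 1:])"

text \<open>One step drops the root \<open>side k\<close> and gains the root
  \<open>side (k + N) = - side k\<close>; this is the ratio
  \<open>(z + side k) / (z - side k)\<close> of the exponential.\<close>

lemma boundary_poly_Suc:
  "boundary_poly (Suc k) * [:- side k, 1:] = boundary_poly k * [:side k, 1:]"
proof -
  let ?f = "\<lambda>j. [:- side (k + j), 1:]"
  have "(\<Prod>j<Suc N. ?f j) = boundary_poly k * ?f N"
    by (simp only: prod.lessThan_Suc boundary_poly_def)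
  moreover have "(\<Prod>j<Suc N. ?f j) = ?f 0 * boundary_poly (Suc k)"
    by (simp only: prod.lessThan_Suc_shift boundary_poly_def add_Suc_right add_Suc o_def)
  ultimately show ?thesis by (simp add: side_add_N mult.commute)
qed

lemma degree_boundary_poly: "degree (boundary_poly 0) \<le> N"
proof -
  have "degree (boundary_poly 0) \<le> (\<Sum>j<N. degree [:- side (0 + j), 1:])"
    unfolding boundary_poly_def using degree_prod_sum_le[of "{..<N}" "\<lambda>j. [:- side (0 + j), 1:]"]
    by (simp add: o_def)
  then show ?thesis by simp
qed

text \<open>The roots of \<open>boundary_poly k\<close> are those of \<open>boundary_poly 0\<close>
  rotated by \<open>q ^ k\<close>.\<close>

lemma poly_boundary_poly:
  "poly (boundary_poly k) z = (\<Sum>i\<le>N. coeff (boundary_poly 0) i * q ^ (k * (N - i)) * z ^ i)"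
proof -
  have "z - side (k + j) = q ^ k * (z / q ^ k - side j)" for j
  proof -
    have "side (k + j) = q ^ k * side j"
      by (subst (1 2) side_eq) (simp add: power_add mult_ac)
    then show ?thesis by (simp add: right_diff_distrib)
  qed
  then have "poly (boundary_poly k) z = (\<Prod>j<N. q ^ k * (z / q ^ k - side j))"
    by (simp add: boundary_poly_def poly_prod)
  also have "\<dots> = q ^ (k * N) * poly (boundary_poly 0) (z / q ^ k)"
    by (simp add: boundary_poly_def poly_prod prod.distrib power_mult)
  also have "poly (boundary_poly 0) (z / q ^ k) = (\<Sum>i\<le>N. coeff (boundary_poly 0) i * (z / q ^ k) ^ i)"
    unfolding poly_altdef using degree_boundary_poly
    by (intro sum.mono_neutral_left) (auto simp: coeff_eq_0)
  also have "q ^ (k * N) * \<dots> = (\<Sum>i\<le>N. coeff (boundary_poly 0) i * q ^ (k * (N - i)) * z ^ i)"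
    unfolding sum_distrib_left
  proof (rule sum.cong[OF refl])
    fix i assume "i \<in> {..N}"
    then have "k * N = k * (N - i) + k * i" by (simp flip: distrib_left)
    then have "q ^ (k * N) = q ^ (k * (N - i)) * (q ^ k) ^ i" by (simp add: power_add power_mult)
    then show "q ^ (k * N) * (coeff (boundary_poly 0) i * (z / q ^ k) ^ i) =
        coeff (boundary_poly 0) i * q ^ (k * (N - i)) * z ^ i"
      by (simp add: power_divide)
  qed
  finally show ?thesis .
qed

text \<open>Comparing coefficients in \<open>boundary_poly_Suc\<close> gives a recursion of
  \<open>q\<close>-binomial type, with factor \<open>q ^ (N - i) - 1\<close> on the lower
  coefficient. It is nonzero for \<open>i < N\<close>, so nonvanishing passes upwards from the
  constant term, a product of sides up to sign.\<close>

lemma coeff_boundary_poly_nonzero: "i \<le> N \<Longrightarrow> coeff (boundary_poly 0) i \<noteq> 0"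
proof (induction i)
  case 0
  have "coeff (boundary_poly 0) 0 = poly (boundary_poly 0) 0" by (simp add: poly_0_coeff_0)
  also have "\<dots> \<noteq> 0" by (simp add: boundary_poly_def poly_prod)
  finally show ?case .
next
  case (Suc i)
  let ?a = "coeff (boundary_poly 0)"
  have "boundary_poly (Suc 0) = (\<Sum>i\<le>N. monom (?a i * q ^ (N - i)) i)"
    by (subst poly_eq_poly_eq_iff[symmetric])
      (auto simp: fun_eq_iff poly_boundary_poly[of "Suc 0"] poly_sum poly_monom)
  then have c: "coeff (boundary_poly (Suc 0)) j = ?a j * q ^ (N - j)" if "j \<le> N" for j
    using that by (simp add: coeff_sum)
  have "coeff (boundary_poly (Suc 0) * [:- side 0, 1:]) (Suc i) = coeff (boundary_poly 0 * [:side 0, 1:]) (Suc i)"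
    using boundary_poly_Suc[of 0] by simp
  then have "?a i * (q ^ (N - i) - 1) = side 0 * ?a (Suc i) * (1 + q ^ (N - Suc i))"
    using Suc.prems by (simp add: c algebra_simps)
  moreover have "?a i \<noteq> 0" "q ^ (N - i) \<noteq> 1"
    using Suc q_power_neq_1[of "N - i"] by auto
  ultimately show ?case by auto
qed

text \<open>Each side of the polygon is a tile edge, so walking along the boundary fixes all corner
  values once the one at \<open>pv 0\<close> is normalised by \<open>C\<close>.\<close>

lemma boundary_exponential_exists:
  assumes z: "cmod z > 1"
  shows "\<exists>F. disc_holomorphic F \<and> (\<forall>k. F (pv k) = poly (boundary_poly k) z)"
proof -
  obtain F where F: "disc_holomorphic F" "\<And>x. F x \<noteq> 0"
    "\<And>v e. tile_edge v e \<Longrightarrow> F (v + e) * (z - e) = F v * (z + e)"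
    using discrete_exponential_exists[OF z] by blast
  define C where "C = poly (boundary_poly 0) z / F (pv 0)"
  have "disc_holomorphic (\<lambda>x. \<Sum>i\<in>{0::nat}. C * F x)"
    by (rule disc_holomorphic_sum) (rule F(1))
  then have hol: "disc_holomorphic (\<lambda>x. C * F x)" by simp
  have "C * F (pv k) = poly (boundary_poly k) z" for k
  proof (induction k)
    case 0
    show ?case using F(2) by (simp add: C_def)
  next
    case (Suc k)
    have "z \<noteq> side k" using z by auto
    have "F (pv (Suc k)) * (z - side k) = F (pv k) * (z + side k)"
      using F(3)[OF tile_edge_side[of k]] by (simp add: side_def)
    then have "C * F (pv (Suc k)) * (z - side k) = poly (boundary_poly k) z * (z + side k)"
      unfolding Suc.IH[symmetric] by (simp add: mult.assoc)
    also have "\<dots> = poly (boundary_poly (Suc k)) z * (z - side k)"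
      using arg_cong[OF boundary_poly_Suc[of k], of "\<lambda>p. poly p z"] by (simp add: algebra_simps)
    finally show ?case using \<open>z \<noteq> side k\<close> by simp
  qed
  then show ?thesis using hol by blast
qed

lemma disc_holomorphic_boundary_values:
  "\<exists>G. disc_holomorphic G \<and> (\<forall>k. G (pv k) = (\<Sum>j\<le>N. b j * q ^ (k * j)))"
proof -
  let ?a = "coeff (boundary_poly 0)"
  \<comment> \<open>Radius 2 meets the requirement \<open>cmod z > 1\<close>.\<close>
  define \<zeta> :: "nat \<Rightarrow> complex" where "\<zeta> m = 2 * cis (2 * pi * real m / real (Suc N))" for m
  have "cmod (\<zeta> m) > 1" for m by (simp add: \<zeta>_def norm_mult)
  then have "\<forall>m. \<exists>F. disc_holomorphic F \<and> (\<forall>k. F (pv k) = poly (boundary_poly k) (\<zeta> m))"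
    using boundary_exponential_exists by blast
  then obtain F where F: "\<And>m. disc_holomorphic (F m)"
    "\<And>m k. F m (pv k) = poly (boundary_poly k) (\<zeta> m)" by metis
  \<comment> \<open>The power \<open>z ^ i\<close> carries \<open>?a i * q ^ (k * (N - i))\<close>,
    whence the reversed index and the division.\<close>
  obtain w where w: "\<And>i. i \<le> N \<Longrightarrow> (\<Sum>m\<le>N. w m * \<zeta> m ^ i) = b (N - i) / ?a i"
    using moments_on_scaled_roots_of_unity[of N "\<lambda>i. b (N - i) / ?a i"] unfolding \<zeta>_def by blast
  define G where "G x = (\<Sum>m\<le>N. w m * F m x)" for x
  have "G (pv k) = (\<Sum>j\<le>N. b j * q ^ (k * j))" for k
  proof -
    have "G (pv k) = (\<Sum>m\<le>N. \<Sum>i\<le>N. ?a i * q ^ (k * (N - i)) * (w m * \<zeta> m ^ i))"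
      by (simp add: G_def F(2) poly_boundary_poly sum_distrib_left mult_ac)
    also have "\<dots> = (\<Sum>i\<le>N. ?a i * q ^ (k * (N - i)) * (\<Sum>m\<le>N. w m * \<zeta> m ^ i))"
      by (subst sum.swap) (simp only: sum_distrib_left)
    also have "\<dots> = (\<Sum>i\<le>N. b (N - i) * q ^ (k * (N - i)))"
      using coeff_boundary_poly_nonzero by (intro sum.cong) (auto simp: w)
    also have "\<dots> = (\<Sum>j\<le>N. b j * q ^ (k * j))"
      by (rule sum.reindex_bij_witness[of _ "\<lambda>i. N - i" "\<lambda>i. N - i"]) auto
    finally show ?thesis .
  qed
  moreover have "disc_holomorphic G"
    unfolding G_def[abs_def] by (rule disc_holomorphic_sum) (rule F(1))
  ultimately show ?thesis by blast
qed

lemma dirichlet_disc_holomorphic: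
  obtains G where "disc_holomorphic G"
    "\<And>k. even k \<longleftrightarrow> even k0 \<Longrightarrow> G (pv k) = (if pv k = pv k0 then 1 else 0)"
    "\<And>k \<theta>. \<lbrakk>even k \<longleftrightarrow> odd k0; \<theta> = pi * (real k - real k0) / (2 * real N)\<rbrakk> \<Longrightarrow>
      sin \<theta> \<noteq> 0 \<and> Im (G (pv k)) = - (cos \<theta> / sin \<theta>) / real N"
proof -
  \<comment> \<open>Fourier coefficients of the unit datum at one corner; dividing by
    \<open>(q ^ k0) ^ j\<close> moves it from index 0 to \<open>k0\<close>.\<close>
  define b where "b j = (if j = 0 \<or> j = N then 1 / 2 else 1) / of_nat N / (q ^ k0) ^ j" for j
  obtain G where G: "disc_holomorphic G" "\<And>k. G (pv k) = (\<Sum>j\<le>N. b j * q ^ (k * j))"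
    using disc_holomorphic_boundary_values by blast
  define x where "x k = q ^ k / q ^ k0" for k
  \<comment> \<open>Because \<open>q ^ N = - 1\<close>, this sign separates the corners with the
    parity of \<open>k0\<close> from the others.\<close>
  have xN: "x k ^ N = (if even k \<longleftrightarrow> even k0 then 1 else - 1)" for k
  proof -
    have "x k ^ N = (q ^ N) ^ k / (q ^ N) ^ k0"
      by (simp only: x_def power_divide power_mult[symmetric] mult.commute)
    then show ?thesis by (simp add: q_power_N uminus_power_if)
  qed
  have val: "G (pv k) = ((\<Sum>j<N. x k ^ j) + (x k ^ N - 1) / 2) / of_nat N" for k
  proof -
    have "G (pv k) = (\<Sum>j\<le>N. (if j = 0 \<or> j = N then 1 / 2 else 1) * x k ^ j) / of_nat N"
      unfolding G(2) sum_divide_distrib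
      by (intro sum.cong refl) (simp add: b_def x_def power_divide power_mult)
    then show ?thesis using sum_geometric_half_ends[of N "x k"] N by simp
  qed
  have val2: "G (pv k) = - ((x k + 1) / (x k - 1)) / of_nat N" if "x k ^ N = - 1" "x k \<noteq> 1" for k
  proof -
    have "(\<Sum>j<N. x k ^ j) + (x k ^ N - 1) / 2 = - 2 / (x k - 1) - 1"
      using geometric_sum[OF that(2), of N] that(1) by simp
    also have "\<dots> = - ((x k + 1) / (x k - 1))" using that(2) by (simp add: field_simps)
    finally show ?thesis unfolding val by simp
  qed
  show thesis
  proof (rule that[OF G(1)])
    fix k :: nat assume "even k \<longleftrightarrow> even k0"
    then have 1: "x k ^ N = 1" by (simp add: xN)
    have 2: "pv k = pv k0 \<longleftrightarrow> x k = 1" by (simp add: pv_eq_iff x_def)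
    show "G (pv k) = (if pv k = pv k0 then 1 else 0)"
    proof (cases "x k = 1")
      case True
      then show ?thesis using N unfolding val 2 by simp
    next
      case False
      then show ?thesis using 1 geometric_sum[OF False, of N] unfolding val 2 by simp
    qed
  next
    fix k :: nat and \<theta> assume k: "even k \<longleftrightarrow> odd k0" and \<theta>: "\<theta> = pi * (real k - real k0) / (2 * real N)"
    then have 1: "x k ^ N = - 1" by (simp add: xN)
    then have 2: "x k \<noteq> 1" by auto
    have "x k = cis (- 2 * \<theta>)"
    proof -
      have "- pi * real k / real N - - pi * real k0 / real N = - 2 * \<theta>"
        unfolding \<theta> using N by (simp add: field_simps)
      then show ?thesis unfolding x_def q_power cis_divide by simp
    qed
    with cis_half_angle_quotient[of \<theta>] 2
    have "sin \<theta> \<noteq> 0" "(x k + 1) / (x k - 1) = \<i> * of_real (cos \<theta> / sin \<theta>)" by simp_all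
    moreover from this(2) have "G (pv k) = - (\<i> * of_real (cos \<theta> / sin \<theta>)) / of_nat N"
      using val2[OF 1 2] by simp
    ultimately show "sin \<theta> \<noteq> 0 \<and> Im (G (pv k)) = - (cos \<theta> / sin \<theta>) / real N"
      by (simp add: Im_divide_of_nat)
  qed
qed

lemma pv_frontier: "pv k \<in> frontier R"
  using pv_in_R[of k] pv_extreme[of k] extreme_point_not_in_interior closure_subset[of R]
  by (auto simp: frontier_def)

lemma boundary_black_eq:
  assumes "proper_coloring T col"
  shows "boundary_black T col R = {pv k | k. col (pv k)}"
  using frontier_vertex pv_frontier pv_tiling_vertex
  by (fastforce simp: boundary_black_def black_vertices_def)

text \<open>The current is the difference of \<open>Im G\<close> at the two white neighbours. With
  \<open>cot s - cot t = sin (t - s) / (sin s * sin t)\<close> and \<open>t - s = pi / N\<close> it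
  takes the claimed form.\<close>

lemma response_eq:
  assumes col: "proper_coloring T col" and black: "col (pv k0)" "col (pv (Suc k))"
  shows "current_out T col (dirichlet_potential T col R (pv k0)) (pv (Suc k)) =
    sin (pi / real N) / (real N *
      sin ((real k - real k0) * pi / (2 * real N)) * sin ((real (Suc (Suc k)) - real k0) * pi / (2 * real N)))"
proof -
  have parity: "even (Suc k) \<longleftrightarrow> even k0"
    using black boundary_coloring_parity[OF col, of k0] boundary_coloring_parity[OF col, of "Suc k"] by blast
  obtain G where G: "disc_holomorphic G"
    "\<And>k. even k \<longleftrightarrow> even k0 \<Longrightarrow> G (pv k) = (if pv k = pv k0 then 1 else 0)"
    "\<And>k \<theta>. \<lbrakk>even k \<longleftrightarrow> odd k0; \<theta> = pi * (real k - real k0) / (2 * real N)\<rbrakk> \<Longrightarrow>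
      sin \<theta> \<noteq> 0 \<and> Im (G (pv k)) = - (cos \<theta> / sin \<theta>) / real N"
    using dirichlet_disc_holomorphic[of k0] by blast
  \<comment> \<open>The value 0 off the black vertices is the convention built into
    \<open>dirichlet_potential\<close>.\<close>
  define u where "u x = (if x \<in> black_vertices T col then Re (G x) else 0)" for x
  have pvb: "pv j \<in> boundary_black T col R" "pv j \<in> black_vertices T col" if "col (pv j)" for j
    using that boundary_black_eq[OF col] by (auto simp: boundary_black_def)
  have flux: "current_out T col u x =
      Im (\<Sum>t\<in>tiles_at x. G (x + second_edge t x) - G (x + first_edge t x))"
    if "x \<in> black_vertices T col" for x
    using current_out_disc_holomorphic[OF col that G(1), of u] by (simp add: u_def)
  have ubd: "u (pv j) = (if pv j = pv k0 then 1 else 0)" if "col (pv j)" for j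
  proof -
    have "even j \<longleftrightarrow> even k0"
      using that black(1) boundary_coloring_parity[OF col, of k0] boundary_coloring_parity[OF col, of j] by blast
    then show ?thesis using G(2)[of j] pvb[OF that] by (simp add: u_def)
  qed
  have "dirichlet_potential T col R (pv k0) = u"
  proof (rule dirichlet_potential_eqI[OF col])
    show "pv k0 \<in> boundary_black T col R" using pvb black by blast
    show "u (pv k0) = 1" using ubd black by simp
    show "u v = 0" if "v \<in> boundary_black T col R" "v \<noteq> pv k0" for v
      using that ubd by (auto simp: boundary_black_eq[OF col])
    show "u x = 0" if "x \<notin> black_vertices T col" for x
      using that by (simp add: u_def)
    show "current_out T col u x = 0" if x: "x \<in> black_vertices T col - boundary_black T col R" for x
    proof -
      have "x \<in> R" using x corner_in_region by (auto simp: black_vertices_def tiling_vertices_def)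
      then have "x \<in> interior R"
        using x closure_subset[of R] by (auto simp: boundary_black_def frontier_def)
      then show ?thesis
        using flux[of x] interior_sum_zero[where v = x and F = G] x by (metis DiffD1 zero_complex.simps(2))
    qed
  qed
  then have "current_out T col (dirichlet_potential T col R (pv k0)) (pv (Suc k)) =
      Im (G (pv (Suc (Suc k)))) - Im (G (pv k))"
    using flux[OF pvb(2)[OF black(2)]] polygon_corner_sum[where k = k and F = G] by simp
  also have "\<dots> = sin (pi / real N) / (real N *
      sin ((real k - real k0) * pi / (2 * real N)) * sin ((real (Suc (Suc k)) - real k0) * pi / (2 * real N)))"
  proof -
    define s t where "s = pi * (real k - real k0) / (2 * real N)"
      and "t = pi * (real (Suc (Suc k)) - real k0) / (2 * real N)"
    have nz: "sin s \<noteq> 0" "sin t \<noteq> 0" and im: "Im (G (pv k)) = - (cos s / sin s) / real N"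
      "Im (G (pv (Suc (Suc k)))) = - (cos t / sin t) / real N"
      using G(3)[of k s] G(3)[of "Suc (Suc k)" t] parity by (auto simp: s_def t_def)
    have "Im (G (pv (Suc (Suc k)))) - Im (G (pv k)) = sin (t - s) / (real N * sin s * sin t)"
      using nz N unfolding im by (simp add: sin_diff field_simps)
    moreover have "t - s = pi / real N" using N by (simp add: s_def t_def field_simps)
    ultimately show ?thesis
      by (simp only: s_def t_def mult.commute[of _ pi])
  qed
  finally show ?thesis .
qed

end

theorem mainTheorem6:
  fixes N :: nat and c :: complex and a :: real and T :: "rhomb set"
    and col :: "complex \<Rightarrow> bool" and s p q :: nat
  assumes "N \<ge> 2"
    and "rhombus_tiling T (reg_polygon N c a)"
    and "proper_coloring T col"
    and "s < 2" and "col (poly_vertex N c a s)"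
    and "1 \<le> p" "p \<le> N" "1 \<le> q" "q \<le> N"
  shows "response T col (reg_polygon N c a) (\<lambda>j. poly_vertex N c a (2 * j + s)) p q =
    (let d = \<bar>real p - real q\<bar> in
       sin (pi / real N) /
       (real N * sin ((2 * d - 1) * pi / (2 * real N)) * sin ((2 * d + 1) * pi / (2 * real N))))"
proof -
  interpret polygon_tiling N c a T
    by unfold_locales (rule assms(1,2))+
  have black: "col (pv (2 * j + s))" for j
    using assms(5) boundary_coloring_parity[OF assms(3), of s]
      boundary_coloring_parity[OF assms(3), of "2 * j + s"] by simp
  \<comment> \<open>The predecessor index names the white neighbours of the corner;
    \<open>1 \<le> q\<close> makes the subtraction exact.\<close>
  define k where "k = 2 * q + s - 1"
  have k: "2 * q + s = Suc k" using assms(8) by (simp add: k_def)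
  define D where "D = real p - real q"
  have kk: "real k - real (2 * p + s) = - (2 * D + 1)"
    "real (Suc (Suc k)) - real (2 * p + s) = - (2 * D - 1)"
    using k by (simp_all add: D_def)
  have "response T col R (\<lambda>j. pv (2 * j + s)) p q =
      sin (pi / real N) / (real N * sin (- (2 * D + 1) * pi / (2 * real N)) *
        sin (- (2 * D - 1) * pi / (2 * real N)))"
    using response_eq[OF assms(3) black[of p], of k] black[of q]
    unfolding response_def k kk by simp
  also have "\<dots> = sin (pi / real N) / (real N * sin ((2 * \<bar>D\<bar> - 1) * pi / (2 * real N)) *
        sin ((2 * \<bar>D\<bar> + 1) * pi / (2 * real N)))"
  \<comment> \<open>For \<open>D \<ge> 0\<close> both sines change sign and trade places; for
    \<open>D < 0\<close> they already have the required form.\<close>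
  proof (cases "D \<ge> 0")
    case True
    have neg: "- (2 * D + 1) * pi / (2 * real N) = - ((2 * D + 1) * pi / (2 * real N))"
      "- (2 * D - 1) * pi / (2 * real N) = - ((2 * D - 1) * pi / (2 * real N))"
      by (simp_all only: minus_mult_left[symmetric] minus_divide_left[symmetric])
    show ?thesis
      unfolding neg sin_minus using True by (simp add: mult_ac)
  next
    case False
    then have "2 * \<bar>D\<bar> - 1 = - (2 * D + 1)" "2 * \<bar>D\<bar> + 1 = - (2 * D - 1)" by simp_all
    then show ?thesis by (simp only:)
  qed
  finally show ?thesis by (simp add: Let_def D_def)
qed

end
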